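(* Let $M$ be an integer, let $N\ge 1$ be an integer and let $Q\ge 1$ be real. For each prime $p\le Q$ let $\mathcal{L}_p\subsetneq \mathbb{Z}/p\mathbb{Z}$ be a proper (possibly empty) subset. Let $Z$ be the number of integers $n\in[M,M+N]$ such that, for every prime $p\le Q$, the class of $n$ modulo $p$ does not belong to $\mathcal{L}_p$. Then $$Z\le \frac{1}{L^*(Q)},\qquad L^*(Q)=\sum_{q\le Q}\frac{\mu^2(q)}{N+\mathfrak{c}\,q(q+Q)}\prod_{p\mid q}\frac{|\mathcal{L}_p|}{p-|\mathcal{L}_p|},$$ where the sum is over positive integers $q\le Q$, the product is over the primes dividing $q$, and $\mathfrak{c}=0.898678\cdots$ is the constant defined in the context.
   Context: $\mu$ is the Möbius function. The constant $\mathfrak{c}$ is $$\mathfrak{c}=\frac43+\frac{2}{\pi^2}\int_0^1\hat J(v)\hat J'(v)\frac{dv}{v}=0.898678\cdots,$$ where $\hat J(0)=1$, $\hat J(t)=\pi t(1-|t|)\cot(\pi t)+|t|$ for $0<|t|<1$, and $\hat J(t)=0$ for $|t|\ge1$. *)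

theory Defs
  imports
    "HOL-Analysis.Analysis"
    "HOL-Computational_Algebra.Squarefree"
begin

definition moebius :: "nat \<Rightarrow> int" where
  "moebius n = (if squarefree n then (- 1) ^ card (prime_factors n) else 0)"

definition J_hat :: "real \<Rightarrow> real" where
  "J_hat t =
    (if t = 0 then 1
     else if \<bar>t\<bar> < 1 then pi * t * (1 - \<bar>t\<bar>) * cot (pi * t) + \<bar>t\<bar>
     else 0)"

text \<open>
  The integrand extends continuously to \<open>[0, 1]\<close>, so the value that the convention
  \<open>x / 0 = 0\<close> gives it at \<open>v = 0\<close> is irrelevant. Numerically the constant is 0.898678...
\<close>
definition sieve_const :: real where
  "sieve_const = 4 / 3 + 2 / pi\<^sup>2 * integral {0..1} (\<lambda>v. J_hat v * deriv J_hat v / v)"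

text \<open>
  A set of residue classes modulo \<open>p\<close> is represented by the set of its least nonnegative
  representatives, a subset of \<open>{0..<p}\<close>.
\<close>
definition sifted_set :: "int \<Rightarrow> int \<Rightarrow> real \<Rightarrow> (nat \<Rightarrow> int set) \<Rightarrow> int set" where
  "sifted_set M N Q L =
    {n. M \<le> n \<and> n \<le> M + N \<and> (\<forall>p. prime p \<and> real p \<le> Q \<longrightarrow> n mod int p \<notin> L p)}"

definition sieve_sum :: "int \<Rightarrow> real \<Rightarrow> (nat \<Rightarrow> int set) \<Rightarrow> real" where
  "sieve_sum N Q L =
    (\<Sum>q \<in> {q::nat. 1 \<le> q \<and> real q \<le> Q}.
       (of_int (moebius q))\<^sup>2 / (of_int N + sieve_const * real q * (real q + Q)) *
       (\<Prod>p \<in> prime_factors q. real (card (L p)) / (real p - real (card (L p)))))"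

end

theory Submission
  imports Defs "HOL-Probability.Sinc_Integral" "HOL-Number_Theory.Totient" "HOL-Real_Asymp.Real_Asymp"
begin

text \<open>
  Let \<open>A\<close> be the sifted set, \<open>T(\<theta>) = (\<Sum>n\<in>A. e(n \<theta>))\<close> and \<open>r = 1 / (q (q + Q))\<close>. Selberg's majorant \<open>S\<close> of the
  interval, with spectrum in \<open>[-r, r]\<close>, gives \<open>|A| \<le> (\<Sum>n\<in>A. S(n))\<close>, which is the integral over
  \<open>[-r, r]\<close> of \<open>T\<close> against the Fourier transform of \<open>S\<close>; hence \<open>|A|\<^sup>2\<close> is at most \<open>\<parallel>S\<parallel>\<^sup>2\<close> times the integral of \<open>|T|\<^sup>2\<close>
  over \<open>[-r, r]\<close>. Montgomery's inequality \<open>g(q) |T(\<beta>)|\<^sup>2 \<le> (\<Sum>a. |T(a/q + \<beta>)|\<^sup>2)\<close> moves this integral to the arcs of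
  radius \<open>r\<close> around the reduced fractions \<open>a/q\<close>. All these arcs, for all \<open>q \<le> Q\<close>, are disjoint modulo 1, and the
  integral of \<open>|T|\<^sup>2\<close> over a period is \<open>|A|\<close>. Summing over \<open>q\<close> gives \<open>|A|\<^sup>2 L\<^sup>* \<le> |A|\<close>.

  It remains to see that \<open>\<parallel>S\<parallel>\<^sup>2 \<le> N + c / r\<close>. After scaling to \<open>r = 1\<close> the interval has length \<open>D = r N\<close>, and
  \<open>\<parallel>S\<parallel>\<^sup>2 - D - c\<close> tends to 0 as \<open>D \<rightarrow> \<infinity>\<close> by the Riemann--Lebesgue lemma. The second difference in \<open>D\<close> (with step 1) is
  elementary and negative, so \<open>\<parallel>S\<parallel>\<^sup>2 - D - c\<close> is concave along \<open>D, D + 1, D + 2, \<dots>\<close>; with limit 0 it is increasing,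
  hence never positive.
\<close>

section \<open>Oscillatory integrals\<close>

text \<open>The removable singularity is filled in, so that \<open>x * snc x = sin x\<close> needs
  no case distinction and \<open>snc\<close> is continuous everywhere.\<close>

definition snc :: "real \<Rightarrow> real" where
  "snc x = (if x = 0 then 1 else sin x / x)"

lemma snc_mult [simp]: "x * snc x = sin x"
  by (simp add: snc_def)

lemma continuous_on_snc [continuous_intros]:
  "continuous_on S f \<Longrightarrow> continuous_on S (\<lambda>x. snc (f x))"
  unfolding snc_def by (rule continuous_on_sinc)

lemma DERIV_Si_snc: "(Si has_real_derivative snc x) (at x)"
  using DERIV_Si[of x] by (simp add: snc_def)

lemma has_integral_snc:
  fixes \<omega> :: real
  shows "((\<lambda>t. \<omega> * snc (\<omega> * t)) has_integral Si \<omega>) {0..1}"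
proof -
  have "((\<lambda>t. \<omega> * snc (\<omega> * t)) has_integral (Si (\<omega> * 1) - Si (\<omega> * 0))) {0..1}"
  proof (rule fundamental_theorem_of_calculus)
    fix x :: real
    have "((\<lambda>t. Si (\<omega> * t)) has_real_derivative snc (\<omega> * x) * \<omega>) (at x within {0..1})"
      by (rule DERIV_chain'[OF _ DERIV_Si_snc, THEN DERIV_subset]) (auto intro!: derivative_eq_intros)
    then show "((\<lambda>t. Si (\<omega> * t)) has_vector_derivative \<omega> * snc (\<omega> * x)) (at x within {0..1})"
      by (simp add: has_real_derivative_iff_has_vector_derivative mult.commute)
  qed simp
  moreover have "Si 0 = 0"
    using Si_neg[of 0] by simp
  ultimately show ?thesis by simp
qed

lemma integral_real_bound:
  fixes f :: "real \<Rightarrow> real"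
  assumes "f integrable_on {0..1}" "\<And>t. t \<in> {0..1} \<Longrightarrow> \<bar>f t\<bar> \<le> B"
  shows "\<bar>integral {0..1} f\<bar> \<le> B"
proof -
  have "0 \<le> B" using assms(2)[of 0] by force
  moreover have "(f has_integral integral {0..1} f) (cbox 0 1)" using assms(1) by (simp add: has_integral_integral)
  ultimately show ?thesis
    using has_integral_bound[of B f "integral {0..1} f" 0 1] assms(2) by simp
qed

text \<open>Approximate \<open>f\<close> uniformly by a polynomial \<open>p\<close>. Integration by
  parts makes the integral of \<open>p\<close> against the cosine of order 1/\<omega>, and the
  approximation error contributes at most \<open>e/2\<close>. The phase \<open>\<delta>\<close> lets
  one proof serve both cosine and sine.\<close>

lemma Riemann_Lebesgue:
  fixes f :: "real \<Rightarrow> real"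
  assumes "continuous_on {0..1} f"
  shows "((\<lambda>\<omega>. integral {0..1} (\<lambda>t. f t * cos (\<omega> * t + \<delta>))) \<longlongrightarrow> 0) at_top"
proof (rule tendstoI)
  fix e :: real
  assume e: "e > 0"
  obtain p where p: "real_polynomial_function p" and fp: "\<And>x. x \<in> {0..1} \<Longrightarrow> \<bar>f x - p x\<bar> < e/2"
    using Stone_Weierstrass_real_polynomial_function[of "{0..1}" f "e/2"] assms e by auto
  obtain p' where p': "real_polynomial_function p'" and dp: "\<And>x. (p has_real_derivative p' x) (at x)"
    using has_real_derivative_polynomial_function[OF p] by blast
  have cp: "continuous_on {0..1} p" and cp': "continuous_on {0..1} p'"
    using p p' continuous_on_polymonial_function by (auto simp: real_polynomial_function_eq)
  have "bounded (p ` {0..1})" "bounded (p' ` {0..1})"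
    using cp cp' by (auto intro!: compact_imp_bounded compact_continuous_image)
  then obtain A B where A: "\<And>x. x \<in> {0..1} \<Longrightarrow> \<bar>p x\<bar> \<le> A" and B: "\<And>x. x \<in> {0..1} \<Longrightarrow> \<bar>p' x\<bar> \<le> B"
    unfolding bounded_iff by fastforce
  have lim: "((\<lambda>\<omega>::real. (2*A+B)/\<omega>) \<longlongrightarrow> 0) at_top"
    by real_asymp
  have ev: "eventually (\<lambda>\<omega>. (2*A+B)/\<omega> < e/2) at_top"
    using order_tendstoD(2)[OF lim, of "e/2"] e by simp
  show "eventually (\<lambda>\<omega>. dist (integral {0..1} (\<lambda>t. f t * cos (\<omega> * t + \<delta>))) 0 < e) at_top"
    using ev eventually_gt_at_top[of 0]
  proof eventually_elim
    case (elim \<omega>)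
    let ?c = "\<lambda>t. cos (\<omega> * t + \<delta>)" and ?s = "\<lambda>t. sin (\<omega> * t + \<delta>) / \<omega>"
    have i1: "((\<lambda>t. p' t * ?s t + p t * ?c t) has_integral (p 1 * ?s 1 - p 0 * ?s 0)) {0..1}"
    proof (rule fundamental_theorem_of_calculus)
      fix x :: real
      have "((\<lambda>t. p t * ?s t) has_real_derivative (p' x * ?s x + p x * ?c x)) (at x)"
        using elim by (auto intro!: derivative_eq_intros dp simp: field_simps)
      then show "((\<lambda>t. p t * ?s t) has_vector_derivative (p' x * ?s x + p x * ?c x)) (at x within {0..1})"
        by (simp add: has_real_derivative_iff_has_vector_derivative has_vector_derivative_at_within)
    qed simp
    have i2: "(\<lambda>t. p' t * ?s t) integrable_on {0..1}" and i3: "(\<lambda>t. (f t - p t) * ?c t) integrable_on {0..1}"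
      by (intro integrable_continuous_interval continuous_intros assms cp cp'; use elim in simp)+
    \<comment> \<open>Here \<open>f * ?c\<close> is written as (\<open>p' * ?s + p * ?c\<close>) -
      \<open>p' * ?s\<close> + (\<open>f - p\<close>) * \<open>?c\<close>; the bracket is an exact
      derivative.\<close>
    have i4: "((\<lambda>t. f t * ?c t) has_integral ((p 1 * ?s 1 - p 0 * ?s 0) - integral {0..1} (\<lambda>t. p' t * ?s t) 
       + integral {0..1} (\<lambda>t. (f t - p t) * ?c t))) {0..1}"
      using has_integral_add[OF has_integral_diff[OF i1 integrable_integral[OF i2]] integrable_integral[OF i3]]
      by (simp add: algebra_simps)
    have sb: "\<bar>a * ?s t\<bar> \<le> C / \<omega>" if "\<bar>a\<bar> \<le> C" for a t C
    proof -
      have "\<bar>a\<bar> * \<bar>sin (\<omega> * t + \<delta>)\<bar> \<le> C * 1"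
        using that by (intro mult_mono) auto
      then show ?thesis using elim by (simp add: abs_mult divide_right_mono)
    qed
    have "\<bar>integral {0..1} (\<lambda>t. p' t * ?s t)\<bar> \<le> B / \<omega>"
      by (rule integral_real_bound[OF i2]) (rule sb, rule B)
    moreover have "\<bar>integral {0..1} (\<lambda>t. (f t - p t) * ?c t)\<bar> \<le> e/2"
    proof (rule integral_real_bound[OF i3])
      fix t :: real assume "t \<in> {0..1}"
      then have "\<bar>f t - p t\<bar> * \<bar>?c t\<bar> \<le> (e/2) * 1"
        using fp[of t] e by (intro mult_mono) auto
      then show "\<bar>(f t - p t) * ?c t\<bar> \<le> e/2" by (simp add: abs_mult)
    qed
    moreover have "\<bar>p 1 * ?s 1\<bar> \<le> A / \<omega>" "\<bar>p 0 * ?s 0\<bar> \<le> A / \<omega>"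
      by (rule sb, rule A, simp)+
    moreover have "(2*A+B)/\<omega> = A/\<omega> + A/\<omega> + B/\<omega>" by (simp add: add_divide_distrib)
    ultimately show ?case
      using elim unfolding integral_unique[OF i4] dist_real_def by linarith
  qed
qed

corollary Riemann_Lebesgue_cos:
  fixes f :: "real \<Rightarrow> real"
  assumes "continuous_on {0..1} f"
  shows "((\<lambda>\<omega>. integral {0..1} (\<lambda>t. f t * cos (\<omega> * t))) \<longlongrightarrow> 0) at_top"
  using Riemann_Lebesgue[OF assms, of 0] by simp

corollary Riemann_Lebesgue_sin:
  fixes f :: "real \<Rightarrow> real"
  assumes "continuous_on {0..1} f"
  shows "((\<lambda>\<omega>. integral {0..1} (\<lambda>t. f t * sin (\<omega> * t))) \<longlongrightarrow> 0) at_top"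
  using Riemann_Lebesgue[OF assms, of "-pi/2"] by (simp add: cos_diff)

text \<open>Adding two terms of the asymptotic expansion to \<open>Si\<close> gives \<open>r\<close>
  with derivative \<open>- 2 * sin x / x^3\<close>. This is dominated by 2/x^3, so \<open>r\<close>
  differs from its limit pi/2 by at most 1/x^2.\<close>

lemma Si_asymptotic: "((\<lambda>x. x * (Si x - pi/2) + cos x) \<longlongrightarrow> 0) at_top"
proof -
  define r where "r x = Si x + cos x / x + sin x / x^2" for x
  have cot: "((\<lambda>x. cos x / x) \<longlongrightarrow> (0::real)) at_top" "((\<lambda>x. sin x / x\<^sup>2) \<longlongrightarrow> (0::real)) at_top"
     "((\<lambda>x. sin x / x) \<longlongrightarrow> (0::real)) at_top"
    by real_asymp+
  have "(r \<longlongrightarrow> pi/2 + 0 + 0) at_top"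
    unfolding r_def by (intro tendsto_add Si_at_top cot)
  then have rlim: "(r \<longlongrightarrow> pi/2) at_top" by simp
  have dr: "(r has_real_derivative (- 2 * sin x / x^3)) (at x)" if "x > 0" for x
    unfolding r_def
    by (rule derivative_eq_intros DERIV_Si_snc refl | use that in \<open>simp add: snc_def field_simps power2_eq_square power3_eq_cube\<close>)+
  have q0: "((\<lambda>x. s / x^2) \<longlongrightarrow> (0::real)) at_top" for s :: real by real_asymp
  \<comment> \<open>The sign \<open>s\<close> treats the upper and the lower bound at once:
    \<open>?h\<close> is nonincreasing and tends to 0, hence nonnegative.\<close>
  have bnd: "s * (r x - pi/2) + 1 / x^2 \<ge> 0" if s: "\<bar>s\<bar> = 1" and x: "x > 0" for s x
  proof -
    let ?h = "\<lambda>x. s * (r x - pi/2) + 1 / x^2"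
    have hl: "(?h \<longlongrightarrow> s * (pi/2 - pi/2) + 0) at_top"
      by (intro tendsto_intros rlim q0)
    have dec: "?h y \<le> ?h x" if "x \<le> y" for y
    proof (rule DERIV_nonpos_imp_nonincreasing[OF that])
      fix z assume z: "x \<le> z" "z \<le> y"
      have zp: "z > 0" using x z by simp
      have "(?h has_real_derivative (s * (- 2 * sin z / z^3) - 2 / z^3)) (at z)"
        by (rule derivative_eq_intros dr zp refl | use zp in \<open>simp add: field_simps power2_eq_square power3_eq_cube\<close>)+
      moreover have "s * (- 2 * sin z / z^3) - 2 / z^3 = - 2 * (s * sin z + 1) / z^3"
        using zp by (simp add: divide_simps)
      moreover have "\<bar>s * sin z\<bar> \<le> 1" using s by (simp add: abs_mult)
      moreover have "- 2 * (s * sin z + 1) / z^3 \<le> 0"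
        using \<open>\<bar>s * sin z\<bar> \<le> 1\<close> zp by (simp add: divide_le_0_iff)
      ultimately show "\<exists>d. (?h has_real_derivative d) (at z) \<and> d \<le> 0" by metis
    qed
    have "\<forall>\<^sub>F y in at_top. ?h y \<le> ?h x"
      using eventually_ge_at_top[of x] by eventually_elim (rule dec)
    then have "s * (pi/2 - pi/2) + 0 \<le> ?h x"
      by (rule tendsto_upperbound[OF hl]) simp
    then show ?thesis by simp
  qed
  have up: "\<forall>\<^sub>F x in at_top. norm (x * (r x - pi/2)) \<le> 1 / x"
    using eventually_gt_at_top[of 0]
  proof eventually_elim
    case (elim x)
    have "\<bar>r x - pi/2\<bar> \<le> 1/x^2" using bnd[of 1 x] bnd[of "-1" x] elim by (auto simp: abs_le_iff)
    then have "x * \<bar>r x - pi/2\<bar> \<le> x * (1/x^2)" using elim by (intro mult_left_mono) auto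
    then show ?case using elim by (simp add: abs_mult power2_eq_square)
  qed
  have "((\<lambda>x::real. 1 / x) \<longlongrightarrow> 0) at_top" by real_asymp
  from Lim_null_comparison[OF up this]
  have "((\<lambda>x. x * (r x - pi/2) - sin x / x) \<longlongrightarrow> 0 - 0) at_top"
    by (intro tendsto_diff cot)
  then have "((\<lambda>x. x * (r x - pi/2) - sin x / x) \<longlongrightarrow> 0) at_top" by simp
  then show ?thesis
  proof (rule Lim_transform_eventually)
    show "\<forall>\<^sub>F x in at_top. x * (r x - pi/2) - sin x / x = x * (Si x - pi/2) + cos x"
      using eventually_gt_at_top[of 0]
      by eventually_elim (simp add: r_def field_simps power2_eq_square)
  qed
qed

section \<open>The function \<open>J_hat\<close> and the constant\<close>

text \<open>The value at 0 is the quadratic Taylor coefficient of \<open>J_hat\<close>. Writing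
  \<open>J_hat\<close> as 1 plus t^2 times a continuous function lets the main terms be integrated
  exactly, while the rest is left to the Riemann-Lebesgue lemma.\<close>

definition J_defect :: "real \<Rightarrow> real" where
  "J_defect t = (if t = 0 then - pi\<^sup>2 / 3 else (J_hat t - 1) / t\<^sup>2)"

lemma J_hat_eq: "J_hat t = 1 + t\<^sup>2 * J_defect t"
  by (simp add: J_defect_def J_hat_def)

lemma J_hat_cot:
  assumes "0 < t" "t < 1"
  shows "J_hat t = pi * t * (1 - t) * cot (pi * t) + t"
  using assms by (simp add: J_hat_def)

text \<open>Only the endpoints need care: pi t cot(pi t) = 1 - pi^2 t^2 / 3 + ... near 0, and (1 -
  t) cot(pi t) tends to -1/pi at 1.\<close>

lemma continuous_on_J_defect: "continuous_on {0..1} J_defect"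
proof -
  let ?f = "\<lambda>t. (pi * t * (1 - t) * cot (pi * t) + t - 1) / t\<^sup>2"
  have eq: "J_defect t = ?f t" if "0 < t" "t < 1" for t
    using that by (simp add: J_defect_def J_hat_cot)
  have sinpos: "sin (pi * t) \<noteq> 0" if "0 < t" "t < 1" for t
  proof -
    have "pi * t < pi * 1" using that by (intro mult_strict_left_mono) auto
    then show ?thesis using sin_gt_zero[of "pi * t"] that by simp
  qed
  have "(?f \<longlongrightarrow> - pi\<^sup>2 / 3) (at_right 0)"
    unfolding cot_def by real_asymp (simp add: field_simps power2_eq_square)
  moreover have "\<forall>\<^sub>F t in at_right 0. ?f t = J_defect t"
    using eventually_at_right_real[OF zero_less_one] by eventually_elim (auto simp: eq)
  ultimately have "(J_defect \<longlongrightarrow> - pi\<^sup>2 / 3) (at_right 0)"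
    by (rule Lim_transform_eventually)
  then have "(J_defect \<longlongrightarrow> J_defect 0) (at_right 0)"
    by (simp add: J_defect_def[of 0])
  moreover have "(?f \<longlongrightarrow> - 1) (at_left 1)"
    unfolding cot_def by real_asymp
  then have "(J_defect \<longlongrightarrow> - 1) (at_left 1)"
  proof (rule Lim_transform_eventually)
    show "\<forall>\<^sub>F t in at_left 1. ?f t = J_defect t"
      using eventually_at_left_real[OF zero_less_one] by eventually_elim (auto simp: eq)
  qed
  then have "(J_defect \<longlongrightarrow> J_defect 1) (at_left 1)"
    by (simp add: J_defect_def[of 1] J_hat_def)
  moreover have "isCont J_defect t" if "0 < t" "t < 1" for t
  proof -
    have "isCont ?f t"
      using sinpos[OF that] that by (intro continuous_intros) auto
    moreover have "\<forall>\<^sub>F t in nhds t. J_defect t = ?f t"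
      using eventually_nhds_in_open[of "{0<..<1}" t] that by (auto elim!: eventually_mono simp: eq)
    ultimately show ?thesis by (simp add: isCont_cong)
  qed
  ultimately show ?thesis
    by (intro continuous_on_IccI) (auto simp: isCont_def)
qed

lemma continuous_on_J_hat: "continuous_on {0..1} J_hat"
  unfolding J_hat_eq[abs_def] by (intro continuous_intros continuous_on_J_defect)

text \<open>Integration by parts removes the derivative: J J' / t is the derivative of (J^2 - 1) /
  (2t) plus (J^2 - 1) / (2t^2), and (J^2 - 1) / t^2 is the continuous function
  \<open>r\<close>.\<close>

lemma sieve_const_eq:
  "sieve_const = 4 / 3 + (integral {0..1} (\<lambda>t. (1 + J_hat t) * J_defect t) - 1) / pi\<^sup>2"
proof -
  define r where "r t = (1 + J_hat t) * J_defect t" for t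
  have cr: "continuous_on {0..1} r"
    unfolding r_def by (intro continuous_intros continuous_on_J_hat continuous_on_J_defect)
  have rt: "r t * t\<^sup>2 = (J_hat t)\<^sup>2 - 1" for t
    unfolding r_def J_hat_eq by (simp add: algebra_simps power2_eq_square)
  have rdiv: "((J_hat t)\<^sup>2 - 1) / (2 * t) = t * r t / 2" if "t \<noteq> 0" for t
    unfolding rt[symmetric] using that by (simp add: power2_eq_square)
  have dJ: "(J_hat has_real_derivative deriv J_hat t) (at t)" if "0 < t" "t < 1" for t
  proof -
    have "pi * t < pi * 1" using that by (intro mult_strict_left_mono) auto
    then have s: "sin (pi * t) \<noteq> 0" using sin_gt_zero[of "pi * t"] that by simp
    have dc: "((\<lambda>t. cot (pi * t)) has_real_derivative - inverse ((sin (pi * t))\<^sup>2) * pi) (at t)"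
      using DERIV_chain2[where f = cot and g = "\<lambda>t. pi * t", OF DERIV_cot[OF s] DERIV_cmult_Id] by simp
    obtain d where d: "((\<lambda>t. pi * t * (1 - t) * cot (pi * t) + t) has_real_derivative d) (at t)"
      by (rule that, (rule derivative_intros dc)+)
    have "(J_hat has_real_derivative d) (at t)"
      by (rule has_field_derivative_transform_within_open[OF d, of "{0<..<1}"])
         (use that in \<open>auto simp: J_hat_cot\<close>)
    then show ?thesis using DERIV_imp_deriv by metis
  qed
  \<comment> \<open>The antiderivative (J^2 - 1) / (2t) is written as \<open>t * r t / 2\<close>,
    which is continuous at 0 too; differentiability is then required only in the interior.\<close>
  have "((\<lambda>t. J_hat t * deriv J_hat t / t - r t / 2) has_integral (1 * r 1 / 2 - 0 * r 0 / 2)) {0..1}"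
  proof (rule fundamental_theorem_of_calculus_interior)
    show "continuous_on {0..1} (\<lambda>t. t * r t / 2)"
      by (intro continuous_intros cr) auto
    fix t :: real assume "t \<in> {0<..<1}"
    then have t: "0 < t" "t < 1" by auto
    have "((\<lambda>t. ((J_hat t)\<^sup>2 - 1) / (2 * t)) has_real_derivative
        J_hat t * deriv J_hat t / t - ((J_hat t)\<^sup>2 - 1) / (2 * t\<^sup>2)) (at t)"
      by (rule derivative_eq_intros dJ t refl | use t in \<open>simp add: field_simps power2_eq_square\<close>)+
    moreover have "((J_hat t)\<^sup>2 - 1) / (2 * t\<^sup>2) = r t / 2"
      using t by (simp add: rt[symmetric])
    ultimately have "((\<lambda>t. ((J_hat t)\<^sup>2 - 1) / (2 * t)) has_real_derivative
        J_hat t * deriv J_hat t / t - r t / 2) (at t)" by simp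
    then have "((\<lambda>t. t * r t / 2) has_real_derivative J_hat t * deriv J_hat t / t - r t / 2) (at t)"
      by (rule has_field_derivative_transform_within_open[of _ _ _ "{0<..<1}"])
         (use t in \<open>auto simp: rdiv\<close>)
    then show "((\<lambda>t. t * r t / 2) has_vector_derivative J_hat t * deriv J_hat t / t - r t / 2) (at t)"
      by (simp add: has_real_derivative_iff_has_vector_derivative)
  qed simp
  from has_integral_add[OF this has_integral_divide[OF integrable_integral[OF integrable_continuous_interval[OF cr]], of 2]]
  have "((\<lambda>t. J_hat t * deriv J_hat t / t) has_integral (r 1 / 2 + integral {0..1} r / 2)) {0..1}"
    by simp
  moreover have "r 1 = -1" using rt[of 1] by (simp add: J_hat_def)
  ultimately have "integral {0..1} (\<lambda>t. J_hat t * deriv J_hat t / t) = (integral {0..1} r - 1) / 2"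
    by (simp add: integral_unique field_simps)
  moreover have "(\<lambda>t. (1 + J_hat t) * J_defect t) = r"
    by (simp add: r_def fun_eq_iff)
  ultimately show ?thesis
    by (simp add: sieve_const_def)
qed

section \<open>Beurling's majorant of the sign function\<close>

lemma has_integral_cos:
  fixes a :: real
  assumes "a \<noteq> 0"
  shows "((\<lambda>t. cos (a * t)) has_integral (sin a / a)) {0..1}"
proof -
  have "((\<lambda>t. cos (a * t)) has_integral (sin (a * 1) / a - sin (a * 0) / a)) {0..1}"
    by (rule fundamental_theorem_of_calculus)
       (use assms in \<open>auto intro!: derivative_eq_intros simp: has_real_derivative_iff_has_vector_derivative[symmetric]\<close>)
  then show ?thesis by simp
qed

lemma has_integral_sin:
  fixes a :: real
  assumes "a \<noteq> 0"
  shows "((\<lambda>t. sin (a * t)) has_integral ((1 - cos a) / a)) {0..1}"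
proof -
  have "((\<lambda>t. sin (a * t)) has_integral (- cos (a * 1) / a - - cos (a * 0) / a)) {0..1}"
    by (rule fundamental_theorem_of_calculus)
       (use assms in \<open>auto intro!: derivative_eq_intros simp: has_real_derivative_iff_has_vector_derivative[symmetric]\<close>)
  then show ?thesis by (simp add: diff_divide_distrib)
qed

lemma has_integral_linear_cos:
  fixes a :: real
  assumes "a \<noteq> 0"
  shows "((\<lambda>t. (1 - t) * cos (a * t)) has_integral ((1 - cos a) / a\<^sup>2)) {0..1}"
proof -
  let ?F = "\<lambda>t. (1 - t) * sin (a * t) / a - cos (a * t) / a\<^sup>2"
  have "((\<lambda>t. (1 - t) * cos (a * t)) has_integral (?F 1 - ?F 0)) {0..1}"
  proof (rule fundamental_theorem_of_calculus)
    fix x :: real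
    have "(?F has_real_derivative (1 - x) * cos (a * x)) (at x within {0..1})"
      using assms by (auto intro!: derivative_eq_intros simp: field_simps power2_eq_square)
    then show "(?F has_vector_derivative (1 - x) * cos (a * x)) (at x within {0..1})"
      by (simp add: has_real_derivative_iff_has_vector_derivative)
  qed simp
  then show ?thesis by (simp add: diff_divide_distrib)
qed

lemma has_integral_linear_sin:
  fixes a :: real
  assumes "a \<noteq> 0"
  shows "((\<lambda>t. (1 - t) * sin (a * t)) has_integral (1 / a - sin a / a\<^sup>2)) {0..1}"
proof -
  let ?F = "\<lambda>t. - (1 - t) * cos (a * t) / a - sin (a * t) / a\<^sup>2"
  have "((\<lambda>t. (1 - t) * sin (a * t)) has_integral (?F 1 - ?F 0)) {0..1}"
  proof (rule fundamental_theorem_of_calculus)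
    fix x :: real
    have "(?F has_real_derivative (1 - x) * sin (a * x)) (at x within {0..1})"
      using assms by (auto intro!: derivative_eq_intros simp: field_simps power2_eq_square)
    then show "(?F has_vector_derivative (1 - x) * sin (a * x)) (at x within {0..1})"
      by (simp add: has_real_derivative_iff_has_vector_derivative)
  qed simp
  then show ?thesis by simp
qed

lemma has_integral_quadratic_cos:
  fixes a :: real
  assumes "a \<noteq> 0"
  shows "((\<lambda>t. (1 - t)\<^sup>2 * cos (a * t)) has_integral (2 / a\<^sup>2 - 2 * sin a / a^3)) {0..1}"
proof -
  let ?F = "\<lambda>t. (1 - t)\<^sup>2 * sin (a * t) / a - 2 * (1 - t) * cos (a * t) / a\<^sup>2 - 2 * sin (a * t) / a^3"
  have "((\<lambda>t. (1 - t)\<^sup>2 * cos (a * t)) has_integral (?F 1 - ?F 0)) {0..1}"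
  proof (rule fundamental_theorem_of_calculus)
    fix x :: real
    have "(?F has_real_derivative (1 - x)\<^sup>2 * cos (a * x)) (at x within {0..1})"
      using assms by (auto intro!: derivative_eq_intros simp: field_simps power2_eq_square power3_eq_cube)
    then show "(?F has_vector_derivative (1 - x)\<^sup>2 * cos (a * x)) (at x within {0..1})"
      by (simp add: has_real_derivative_iff_has_vector_derivative)
  qed simp
  then show ?thesis by simp
qed

text \<open>
  The first summand is the transform of \<open>2 J\<close>, integrated, and the second one is that of the Fejer kernel; their sum is
  \<open>(sin \<pi>x / \<pi>)\<^sup>2 ((\<Sum>n\<ge>0. (x - n)\<^bsup>-2\<^esup>) - (\<Sum>n<0. (x - n)\<^bsup>-2\<^esup>) + 2 / x)\<close>.
\<close>

definition beurling :: "real \<Rightarrow> real" where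
  "beurling x = integral {0..1} (\<lambda>t. 4 * x * J_hat t * snc (2 * pi * x * t) + 2 * (1 - t) * cos (2 * pi * x * t))"

lemma beurling_integrand_integrable:
  "(\<lambda>t. 4 * x * J_hat t * snc (2 * pi * x * t) + 2 * (1 - t) * cos (2 * pi * x * t)) integrable_on {0..1}"
  by (intro integrable_continuous_interval continuous_intros continuous_on_J_hat)

text \<open>Inserting \<open>J_hat_eq\<close> splits off (2/pi) Si(2 pi x), which tends to 1; both
  remaining integrals vanish in the limit by the Riemann-Lebesgue lemma.\<close>

lemma beurling_tendsto_1: "(beurling \<longlongrightarrow> 1) at_top"
proof -
  let ?w = "\<lambda>x. 2 * pi * x"
  have w: "filterlim ?w at_top at_top" by real_asymp
  have c1: "continuous_on {0..1} (\<lambda>t. t * J_defect t)" and c2: "continuous_on {0..1} (\<lambda>t::real. 1 - t)"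
    by (intro continuous_intros continuous_on_J_defect)+
  have eq: "beurling x = 2 / pi * Si (?w x) + 2 / pi * integral {0..1} (\<lambda>t. t * J_defect t * sin (?w x * t))
       + 2 * integral {0..1} (\<lambda>t. (1 - t) * cos (?w x * t))" for x
  proof -
    have i1: "(\<lambda>t. t * J_defect t * sin (?w x * t)) integrable_on {0..1}"
      and i2: "(\<lambda>t. (1 - t) * cos (?w x * t)) integrable_on {0..1}"
      by (intro integrable_continuous_interval continuous_intros c1 c2)+
    have "4 * x * J_hat t * snc (?w x * t) + 2 * (1 - t) * cos (?w x * t) =
      2 / pi * (?w x * snc (?w x * t)) + 2 / pi * (t * J_defect t * sin (?w x * t)) + 2 * ((1 - t) * cos (?w x * t))" for t
    proof -
      define z where "z = snc (?w x * t)"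
      have "sin (?w x * t) = ?w x * t * z" by (simp add: z_def)
      then show ?thesis
        unfolding J_hat_eq z_def[symmetric] by (simp add: field_simps power2_eq_square)
    qed
    then show ?thesis
      unfolding beurling_def
      by (simp only:) (intro integral_unique has_integral_add has_integral_mult_right has_integral_snc
         integrable_integral i1 i2)
  qed
  have "((\<lambda>x. 2 / pi * Si (?w x) + 2 / pi * integral {0..1} (\<lambda>t. t * J_defect t * sin (?w x * t))
       + 2 * integral {0..1} (\<lambda>t. (1 - t) * cos (?w x * t))) \<longlongrightarrow> 2 / pi * (pi / 2) + 2 / pi * 0 + 2 * 0) at_top"
    by (intro tendsto_add tendsto_mult tendsto_const filterlim_compose[OF Si_at_top w]
          filterlim_compose[OF Riemann_Lebesgue_sin[OF c1] w] filterlim_compose[OF Riemann_Lebesgue_cos[OF c2] w])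
  then show ?thesis unfolding eq[abs_def] by simp
qed

text \<open>The cotangent in \<open>J_hat\<close> cancels in the difference, because \<open>sin(u + 2p) - sin u\<close> is a multiple of \<open>sin p\<close>.\<close>

lemma beurling_step:
  assumes "x > 0"
  shows "beurling x - beurling (x + 1) = (1 - cos (2 * pi * x)) / (pi\<^sup>2 * x * (x + 1)\<^sup>2)"
proof -
  let ?f = "\<lambda>x t. 4 * x * J_hat t * snc (2 * pi * x * t) + 2 * (1 - t) * cos (2 * pi * x * t)"
  let ?g = "\<lambda>t. - 4 * ((1 - t) * cos (2 * pi * (x + 1) * t))
              - 2 / pi * (sin (2 * pi * (x + 1) * t) - sin (2 * pi * x * t))"
  have "((\<lambda>t. ?f x t - ?f (x + 1) t) has_integral (beurling x - beurling (x + 1))) {0..1}"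
    unfolding beurling_def by (intro has_integral_diff integrable_integral beurling_integrand_integrable)
  moreover have "(?g has_integral (- 4 * ((1 - cos (2 * pi * (x + 1))) / (2 * pi * (x + 1))\<^sup>2)
     - 2 / pi * ((1 - cos (2 * pi * (x + 1))) / (2 * pi * (x + 1)) - (1 - cos (2 * pi * x)) / (2 * pi * x)))) {0..1}"
    using assms by (intro has_integral_diff has_integral_mult_right has_integral_linear_cos has_integral_sin) auto
  then have "((\<lambda>t. ?f x t - ?f (x + 1) t) has_integral (- 4 * ((1 - cos (2 * pi * (x + 1))) / (2 * pi * (x + 1))\<^sup>2)
     - 2 / pi * ((1 - cos (2 * pi * (x + 1))) / (2 * pi * (x + 1)) - (1 - cos (2 * pi * x)) / (2 * pi * x)))) {0..1}"
  \<comment> \<open>The endpoints are discarded because the cotangent formula for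
    \<open>J_hat\<close> is available only strictly between them.\<close>
  proof (rule has_integral_spike_finite[of "{0,1}", rotated 2])
    fix t :: real assume "t \<in> {0..1} - {0, 1}"
    then have t: "0 < t" "t < 1" by auto
    have "pi * t < pi * 1" using t by (intro mult_strict_left_mono) auto
    then have s: "sin (pi * t) \<noteq> 0" using sin_gt_zero[of "pi * t"] t by simp
    define u where "u = 2 * pi * x * t"
    define p where "p = pi * t"
    have a: "2 * pi * (x + 1) * t = u + 2 * p" by (simp add: u_def p_def algebra_simps)
    have j: "4 * x * J_hat t * snc u = 2 * ((1 - t) * cot p + 1 / pi) * sin u"
            "4 * (x + 1) * J_hat t * snc (u + 2 * p) = 2 * ((1 - t) * cot p + 1 / pi) * sin (u + 2 * p)"
    proof -
      have *: "4 * y * J_hat t * snc (2 * pi * y * t) = 2 * ((1 - t) * cot p + 1 / pi) * sin (2 * pi * y * t)" for y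
      proof -
        define z where "z = snc (2 * pi * y * t)"
        have "sin (2 * pi * y * t) = 2 * pi * y * t * z" by (simp add: z_def)
        then show ?thesis
          unfolding J_hat_cot[OF t] p_def z_def[symmetric] by (simp add: field_simps)
      qed
      show "4 * x * J_hat t * snc u = 2 * ((1 - t) * cot p + 1 / pi) * sin u"
        using *[of x] by (simp add: u_def)
      show "4 * (x + 1) * J_hat t * snc (u + 2 * p) = 2 * ((1 - t) * cot p + 1 / pi) * sin (u + 2 * p)"
        using *[of "x + 1"] by (simp only: a)
    qed
    have tr: "cot p * (sin u - sin (u + 2 * p)) + cos u - cos (u + 2 * p) = - 2 * cos (u + 2 * p)"
    proof -
      have h1: "sin u - sin (u + 2 * p) = - 2 * sin p * cos (u + p)"
        using sin_diff_sin[of u "u + 2 * p"] by (simp add: add_divide_distrib)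
      have h2: "cos u - cos (u + 2 * p) = 2 * (sin (u + p) * sin p)"
        using cos_diff_cos[of u "u + 2 * p"] by (simp add: add_divide_distrib)
      have h3: "cos (u + 2 * p) = cos (u + p) * cos p - sin (u + p) * sin p"
        using cos_add[of "u + p" p] by (simp add: algebra_simps)
      have h4: "cot p * (sin u - sin (u + 2 * p)) = - 2 * (cos (u + p) * cos p)"
        unfolding h1 using s by (simp add: cot_def p_def)
      show ?thesis using h2 h3 h4 by linarith
    qed
    have "?f x t - ?f (x + 1) t = 2 * (1 - t) * (cot p * (sin u - sin (u + 2 * p)) + cos u - cos (u + 2 * p))
        + 2 / pi * (sin u - sin (u + 2 * p))"
      unfolding a j u_def[symmetric] by (simp add: algebra_simps)
    also have "\<dots> = ?g t"
      unfolding tr a u_def[symmetric] by (simp add: algebra_simps)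
    finally show "?f x t - ?f (x + 1) t = ?g t" .
  qed simp
  ultimately have "beurling x - beurling (x + 1) = - 4 * ((1 - cos (2 * pi * (x + 1))) / (2 * pi * (x + 1))\<^sup>2)
     - 2 / pi * ((1 - cos (2 * pi * (x + 1))) / (2 * pi * (x + 1)) - (1 - cos (2 * pi * x)) / (2 * pi * x))"
    by (rule has_integral_unique)
  moreover have "cos (2 * pi * (x + 1)) = cos (2 * pi * x)"
    using cos_periodic[of "2 * pi * x"] by (simp add: algebra_simps)
  moreover have "- 4 * (K / (2 * pi * (x + 1))\<^sup>2) - 2 / pi * (K / (2 * pi * (x + 1)) - K / (2 * pi * x))
      = K / (pi\<^sup>2 * x * (x + 1)\<^sup>2)" for K
    using assms by (simp add: divide_simps) (simp add: power2_eq_square algebra_simps)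
  ultimately show ?thesis by (simp only:)
qed

text \<open>By \<open>beurling_step\<close> the values at x, x + 1, x + 2, ... decrease, and their
  limit is 1. At x = 0, where the step formula does not apply, the integrand reduces to 2(1 -
  t).\<close>

lemma beurling_ge_1:
  assumes "x \<ge> 0"
  shows "beurling x \<ge> 1"
proof (cases "x = 0")
  case True
  have "((\<lambda>t::real. 2 * (1 - t)) has_integral (2 * 1 - 1\<^sup>2 - (2 * 0 - 0\<^sup>2))) {0..1}"
    by (rule fundamental_theorem_of_calculus)
       (auto intro!: derivative_eq_intros simp: has_real_derivative_iff_has_vector_derivative[symmetric])
  then show ?thesis by (simp add: beurling_def True integral_unique)
next
  case False
  then have x: "x > 0" using assms by simp
  have "decseq (\<lambda>k. beurling (x + real k))"
  proof (rule decseq_SucI)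
    fix k :: nat
    have "beurling (x + real k) - beurling (x + real k + 1) \<ge> 0"
      unfolding beurling_step[OF add_pos_nonneg[OF x of_nat_0_le_iff]] using x
      by (intro divide_nonneg_nonneg mult_nonneg_nonneg) auto
    then show "beurling (x + Suc k) \<le> beurling (x + k)" by (simp add: add_ac)
  qed
  moreover have "(\<lambda>k. beurling (x + real k)) \<longlonglongrightarrow> 1"
    by (rule filterlim_compose[OF beurling_tendsto_1]) real_asymp
  ultimately have "1 \<le> beurling (x + real 0)" by (rule decseq_ge)
  then show ?thesis by simp
qed

section \<open>Selberg's majorant of an interval and its norm\<close>

text \<open>
  \<open>selberg_hat D\<close> is, on \<open>[0, 1]\<close>, the even Fourier transform of \<open>S(x + D / 2)\<close>, where
  \<open>S(x) = (beurling x + beurling (D - x)) / 2\<close> majorizes \<open>[0, D]\<close>; the factor 2 in the norm accounts for \<open>[-1, 0]\<close>.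
\<close>

definition selberg_hat :: "real \<Rightarrow> real \<Rightarrow> real" where
  "selberg_hat D t = J_hat t * (D * snc (pi * D * t)) + (1 - t) * cos (pi * D * t)"

definition selberg_norm :: "real \<Rightarrow> real" where
  "selberg_norm D = integral {0..1} (\<lambda>t. 2 * (selberg_hat D t)\<^sup>2)"

lemma continuous_on_selberg_hat: "continuous_on {0..1} (selberg_hat D)"
  unfolding selberg_hat_def[abs_def]
  by (intro continuous_intros continuous_on_J_hat)

text \<open>The product-to-sum formulas turn the integral into the mean of \<open>beurling x\<close>
  and \<open>beurling (D - x)\<close>, and both arguments are nonnegative on the interval.\<close>

lemma selberg_majorant:
  assumes "0 \<le> x" "x \<le> D"
  shows "1 \<le> integral {0..1} (\<lambda>t. 2 * selberg_hat D t * cos (pi * (2 * x - D) * t))"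
proof -
  let ?f = "\<lambda>x t. 4 * x * J_hat t * snc (2 * pi * x * t) + 2 * (1 - t) * cos (2 * pi * x * t)"
  \<comment> \<open>With \<open>a\<close> = pi x t and \<open>b\<close> = pi (D - x) t this is 2
    sin(a + b) cos(a - b) = sin 2a + sin 2b, divided by 2 pi t.\<close>
  have tr: "D * snc (pi * D * t) * cos (pi * (2 * x - D) * t)
      = x * snc (2 * pi * x * t) + (D - x) * snc (2 * pi * (D - x) * t)" for t
  proof (cases "t = 0")
    case True then show ?thesis by (simp add: snc_def)
  next
    case False
    define a b where "a = pi * x * t" and "b = pi * (D - x) * t"
    have ab: "pi * D * t = a + b" "pi * (2 * x - D) * t = a - b" "2 * pi * x * t = 2 * a" "2 * pi * (D - x) * t = 2 * b"
      by (simp_all add: a_def b_def algebra_simps)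
    have "pi * t * (D * snc (pi * D * t) * cos (pi * (2 * x - D) * t)) = (pi * D * t * snc (pi * D * t)) * cos (a - b)"
      unfolding ab(2) by (simp only: mult_ac)
    also have "\<dots> = sin (a + b) * cos (a - b)" unfolding snc_mult ab(1) ..
    also have "\<dots> = (sin (2 * a) + sin (2 * b)) / 2"
      using sin_times_cos[of "a + b" "a - b"] by simp
    also have "\<dots> = ((2 * pi * x * t) * snc (2 * pi * x * t) + (2 * pi * (D - x) * t) * snc (2 * pi * (D - x) * t)) / 2"
      unfolding snc_mult ab(3,4) ..
    also have "(2 * pi * x * t * K + 2 * pi * (D - x) * t * L) / 2 = pi * t * (x * K + (D - x) * L)" for K L
      by (simp add: field_simps)
    finally show ?thesis using False by simp
  qed
  have tc: "2 * cos (pi * D * t) * cos (pi * (2 * x - D) * t) = cos (2 * pi * x * t) + cos (2 * pi * (D - x) * t)" for t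
  proof -
    have "pi * D * t - pi * (2 * x - D) * t = 2 * pi * (D - x) * t" "pi * D * t + pi * (2 * x - D) * t = 2 * pi * x * t"
      by (simp_all add: algebra_simps)
    then show ?thesis
      using cos_times_cos[of "pi * D * t" "pi * (2 * x - D) * t"] by simp
  qed
  have "2 * selberg_hat D t * cos (pi * (2 * x - D) * t) = 1 / 2 * (?f x t + ?f (D - x) t)" for t
  proof -
    have "2 * selberg_hat D t * cos (pi * (2 * x - D) * t)
      = 2 * J_hat t * (D * snc (pi * D * t) * cos (pi * (2 * x - D) * t))
        + (1 - t) * (2 * cos (pi * D * t) * cos (pi * (2 * x - D) * t))"
      by (simp add: selberg_hat_def algebra_simps)
    then show ?thesis unfolding tr tc by (simp add: algebra_simps)
  qed
  then have "integral {0..1} (\<lambda>t. 2 * selberg_hat D t * cos (pi * (2 * x - D) * t)) = 1 / 2 * (beurling x + beurling (D - x))"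
    unfolding beurling_def
    by (simp only:) (intro integral_unique has_integral_mult_right has_integral_add integrable_integral
        beurling_integrand_integrable)
  then show ?thesis using beurling_ge_1[of x] beurling_ge_1[of "D - x"] assms by simp
qed

text \<open>
  With \<open>p = \<pi>t\<close>, the second difference of \<open>cos (2 \<pi>Dt)\<close> and \<open>sin (2 \<pi>Dt)\<close> has the factor \<open>sin\<^sup>2 p\<close>, which cancels
  the squared cotangent of \<open>J_hat\<close> and leaves an elementary integral.
\<close>

lemma selberg_norm_second_difference:
  assumes D: "D > 0"
  shows "selberg_norm (D + 2) - 2 * selberg_norm (D + 1) + selberg_norm D =
    - 2 / (pi\<^sup>2 * (D + 1) * (D + 2)\<^sup>2) - sin (2 * pi * D) * (3 * D + 4) / (pi^3 * D * (D + 1)\<^sup>2 * (D + 2)^3)"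
proof -
  let ?f = "\<lambda>D t. 2 * (selberg_hat D t)\<^sup>2"
  let ?a = "2 * pi * (D + 2)" and ?b = "2 * pi * (D + 1)" and ?c = "2 * pi * D"
  let ?g = "\<lambda>t. 4 * ((1 - t)\<^sup>2 * cos (?a * t)) + 4 / pi * ((1 - t) * sin (?a * t) - (1 - t) * sin (?b * t))
              + 1 / pi\<^sup>2 * (2 * cos (?b * t) - cos (?a * t) - cos (?c * t))"
  let ?I = "4 * (2 / ?a\<^sup>2 - 2 * sin ?a / ?a^3) + 4 / pi * ((1 / ?a - sin ?a / ?a\<^sup>2) - (1 / ?b - sin ?b / ?b\<^sup>2))
              + 1 / pi\<^sup>2 * (2 * (sin ?b / ?b) - sin ?a / ?a - sin ?c / ?c)"
  have int: "?f D integrable_on {0..1}" for D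
    by (intro integrable_continuous_interval continuous_intros continuous_on_selberg_hat)
  have "((\<lambda>t. ?f (D + 2) t - 2 * ?f (D + 1) t + ?f D t) has_integral
      (selberg_norm (D + 2) - 2 * selberg_norm (D + 1) + selberg_norm D)) {0..1}"
    unfolding selberg_norm_def by (intro has_integral_add has_integral_diff has_integral_mult_right integrable_integral int)
  moreover have "(?g has_integral ?I) {0..1}"
    using D by (intro has_integral_add has_integral_diff has_integral_mult_right has_integral_quadratic_cos
        has_integral_linear_sin has_integral_cos) auto
  then have "((\<lambda>t. ?f (D + 2) t - 2 * ?f (D + 1) t + ?f D t) has_integral ?I) {0..1}"
  proof (rule has_integral_spike_finite[of "{0,1}", rotated 2])
    fix t :: real assume "t \<in> {0..1} - {0, 1}"
    then have t: "0 < t" "t < 1" by auto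
    have "pi * t < pi * 1" using t by (intro mult_strict_left_mono) auto
    then have s: "sin (pi * t) \<noteq> 0" using sin_gt_zero[of "pi * t"] t by simp
    define r where "r = 1 - t"
    define p where "p = pi * t"
    \<comment> \<open>This is \<open>J_hat t\<close> / (pi t), so that
      \<open>selberg_hat E t\<close> becomes j sin(pi E t) + r cos(pi E t).\<close>
    define j where "j = r * cot p + 1 / pi"
    define b where "b = ?b * t"
    \<comment> \<open>The three frequencies of the second difference are placed symmetrically around
      the middle one.\<close>
    have ang: "?a * t = b + 2 * p" "?c * t = b - 2 * p" "?b * t = b"
      by (simp_all add: b_def p_def algebra_simps)
    have sq: "?f E t = j\<^sup>2 + r\<^sup>2 - (j\<^sup>2 - r\<^sup>2) * cos (2 * pi * E * t) + 2 * j * r * sin (2 * pi * E * t)" for E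
    proof -
      define z where "z = snc (pi * E * t)"
      define e where "e = pi * E * t"
      have e2: "2 * pi * E * t = 2 * e" by (simp add: e_def)
      have "sin e = pi * E * t * z" by (simp add: z_def e_def)
      then have "J_hat t * (E * z) = j * sin e"
        unfolding J_hat_cot[OF t] j_def p_def r_def by (simp add: field_simps)
      then have "selberg_hat E t = j * sin e + r * cos e"
        by (simp add: selberg_hat_def z_def e_def r_def)
      moreover have "2 * (j * S + r * C)\<^sup>2 = j\<^sup>2 + r\<^sup>2 - (j\<^sup>2 - r\<^sup>2) * (C\<^sup>2 - S\<^sup>2) + 2 * j * r * (2 * S * C)"
        if "S\<^sup>2 + C\<^sup>2 = 1" for S C :: real
        using that by algebra
      ultimately show ?thesis unfolding e2 cos_double sin_double by simp
    qed
    \<comment> \<open>Each factor \<open>j\<close> absorbs one sine, which clears its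
      cotangent.\<close>
    have js: "j * sin p = r * cos p + sin p / pi"
      using s by (simp add: j_def cot_def p_def field_simps)
    have c2: "cos (b + 2 * p) - 2 * cos b + cos (b - 2 * p) = - 4 * (sin p)\<^sup>2 * cos b"
      and s2: "sin (b + 2 * p) - 2 * sin b + sin (b - 2 * p) = - 4 * (sin p)\<^sup>2 * sin b"
    proof -
      have "cos (b + 2 * p) - 2 * cos b + cos (b - 2 * p) = 2 * cos b * (cos (2 * p) - 1)"
        "sin (b + 2 * p) - 2 * sin b + sin (b - 2 * p) = 2 * sin b * (cos (2 * p) - 1)"
        by (simp_all add: cos_add cos_diff sin_add sin_diff algebra_simps)
      then show "cos (b + 2 * p) - 2 * cos b + cos (b - 2 * p) = - 4 * (sin p)\<^sup>2 * cos b"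
        "sin (b + 2 * p) - 2 * sin b + sin (b - 2 * p) = - 4 * (sin p)\<^sup>2 * sin b"
        by (simp_all add: cos_double_sin)
    qed
    have "?f (D + 2) t - 2 * ?f (D + 1) t + ?f D t
       = - (j\<^sup>2 - r\<^sup>2) * (cos (b + 2 * p) - 2 * cos b + cos (b - 2 * p))
         + 2 * j * r * (sin (b + 2 * p) - 2 * sin b + sin (b - 2 * p))"
      unfolding sq ang by (simp add: algebra_simps)
    also have "\<dots> = 4 * (((j * sin p)\<^sup>2 - (r * sin p)\<^sup>2) * cos b - 2 * (j * sin p) * (r * sin p) * sin b)"
      unfolding c2 s2 by (simp add: algebra_simps power2_eq_square)
    also have "\<dots> = 4 * (r\<^sup>2 * cos (b + 2 * p)) + 4 / pi * (r * sin (b + 2 * p) - r * sin b)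
              + 1 / pi\<^sup>2 * (2 * cos b - cos (b + 2 * p) - cos (b - 2 * p))"
    proof -
      define S where "S = sin p"
      define C where "C = cos p"
      have SC: "C\<^sup>2 = 1 - S\<^sup>2" by (simp add: S_def C_def cos_squared_eq)
      have e1: "cos (b + 2 * p) = cos b * (1 - 2 * S\<^sup>2) - sin b * (2 * S * C)"
        by (simp add: cos_add cos_double_sin sin_double S_def C_def)
      have e2: "sin (b + 2 * p) - sin b = - 2 * S\<^sup>2 * sin b + cos b * (2 * S * C)"
        unfolding sin_add cos_double_sin sin_double S_def C_def by (simp add: algebra_simps)
      have e3: "2 * cos b - cos (b + 2 * p) - cos (b - 2 * p) = 4 * S\<^sup>2 * cos b"
        using c2 by (simp add: S_def)
      have e4: "r * sin (b + 2 * p) - r * sin b = r * (- 2 * S\<^sup>2 * sin b + cos b * (2 * S * C))"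
        unfolding e2[symmetric] by (simp add: algebra_simps)
      have "4 * (((r * C + S / pi)\<^sup>2 - (r * S)\<^sup>2) * cos b - 2 * (r * C + S / pi) * (r * S) * sin b)
        = 4 * (r\<^sup>2 * (cos b * (C\<^sup>2 - S\<^sup>2) - sin b * (2 * S * C)))
          + 4 / pi * (r * (- 2 * S\<^sup>2 * sin b + cos b * (2 * S * C))) + 1 / pi\<^sup>2 * (4 * S\<^sup>2 * cos b)"
        by (simp add: field_simps) (simp add: power2_eq_square algebra_simps)
      moreover have "C\<^sup>2 - S\<^sup>2 = 1 - 2 * S\<^sup>2" using SC by simp
      ultimately show ?thesis unfolding js e3 e4 unfolding e1 S_def[symmetric] C_def[symmetric] by simp
    qed
    finally show "?f (D + 2) t - 2 * ?f (D + 1) t + ?f D t = ?g t"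
      unfolding ang r_def .
  qed simp
  ultimately have "selberg_norm (D + 2) - 2 * selberg_norm (D + 1) + selberg_norm D = ?I"
    by (rule has_integral_unique)
  moreover have "sin ?a = sin ?c" "sin ?b = sin ?c"
    using sin_periodic[of "?c"] sin_periodic[of "?b"] by (simp_all add: algebra_simps)
  \<comment> \<open>The three angles differ by multiples of 2 pi, so \<open>K\<close> stands for
    their common sine. Both sides are affine in \<open>K\<close>: \<open>p1\<close> compares the
    constant terms and \<open>p2\<close> the coefficients.\<close>
  moreover have "4 * (2 / ?a\<^sup>2 - 2 * K / ?a^3) + 4 / pi * ((1 / ?a - K / ?a\<^sup>2) - (1 / ?b - K / ?b\<^sup>2))
              + 1 / pi\<^sup>2 * (2 * (K / ?b) - K / ?a - K / ?c)
     = - 2 / (pi\<^sup>2 * (D + 1) * (D + 2)\<^sup>2) - K * (3 * D + 4) / (pi^3 * D * (D + 1)\<^sup>2 * (D + 2)^3)" for K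
  proof -
    have nz: "D \<noteq> 0" "D + 1 \<noteq> 0" "D + 2 \<noteq> 0" "pi \<noteq> 0" using D by auto
    have p1: "4 * (2 / ?a\<^sup>2) + 4 / pi * (1 / ?a - 1 / ?b) = - 2 / (pi\<^sup>2 * (D + 1) * (D + 2)\<^sup>2)"
      using nz by (simp add: divide_simps) (simp add: power2_eq_square algebra_simps)
    have p2: "- 8 / ?a^3 + 4 / pi * (1 / ?b\<^sup>2 - 1 / ?a\<^sup>2) + 1 / pi\<^sup>2 * (2 / ?b - 1 / ?a - 1 / ?c)
        = - ((3 * D + 4) / (pi^3 * D * (D + 1)\<^sup>2 * (D + 2)^3))"
    proof -
      define A B where "A = D + 2" and "B = D + 1"
      have nz': "A \<noteq> 0" "B \<noteq> 0" using nz by (simp_all add: A_def B_def)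
      have "- 8 / (2 * pi * A)^3 + 4 / pi * (1 / (2 * pi * B)\<^sup>2 - 1 / (2 * pi * A)\<^sup>2)
          + 1 / pi\<^sup>2 * (2 / (2 * pi * B) - 1 / (2 * pi * A) - 1 / ?c)
        = (- D * B\<^sup>2 + D * A^3 - D * A * B\<^sup>2 + D * B * A^3 - D * B\<^sup>2 * A\<^sup>2 / 2 - B\<^sup>2 * A^3 / 2)
          / (pi^3 * D * B\<^sup>2 * A^3)"
        using nz nz' by (simp add: field_simps power2_eq_square power3_eq_cube)
      moreover have "- D * B\<^sup>2 + D * A^3 - D * A * B\<^sup>2 + D * B * A^3 - D * B\<^sup>2 * A\<^sup>2 / 2 - B\<^sup>2 * A^3 / 2 = - (3 * D + 4)"
        unfolding A_def B_def by (simp add: field_simps power2_eq_square power3_eq_cube)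
      ultimately show ?thesis by (simp only: A_def B_def minus_divide_left)
    qed
    have lin: "4 * (2 / a\<^sup>2 - 2 * K / a^3) + 4 / pi * ((1 / a - K / a\<^sup>2) - (1 / b - K / b\<^sup>2))
              + 1 / pi\<^sup>2 * (2 * (K / b) - K / a - K / c) =
        (4 * (2 / a\<^sup>2) + 4 / pi * (1 / a - 1 / b)) +
        K * (- 8 / a^3 + 4 / pi * (1 / b\<^sup>2 - 1 / a\<^sup>2) + 1 / pi\<^sup>2 * (2 / b - 1 / a - 1 / c))" for a b c :: real
      by (simp add: divide_inverse algebra_simps)
    show ?thesis unfolding lin[of ?a ?b ?c] p1 p2 by simp
  qed
  ultimately show ?thesis by simp
qed

text \<open>For D up to 1/2 the sine is nonnegative, so both terms of the second difference have the
  right sign. Beyond 1/2 the trivial bound on the sine suffices, because 3 < pi and 1 < 2D.\<close>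

lemma selberg_norm_concave:
  assumes D: "D > 0"
  shows "selberg_norm (D + 2) - selberg_norm (D + 1) \<le> selberg_norm (D + 1) - selberg_norm D"
proof -
  have "- sin (2 * pi * D) * (3 * D + 4) / (pi^3 * D * (D + 1)\<^sup>2 * (D + 2)^3) \<le> 2 / (pi\<^sup>2 * (D + 1) * (D + 2)\<^sup>2)"
  proof (cases "D \<le> 1 / 2")
    case True
    have "2 * pi * D \<le> 2 * pi * (1/2)" using True by (intro mult_left_mono) auto
    then have "sin (2 * pi * D) \<ge> 0" using D by (intro sin_ge_zero) auto
    then have "- sin (2 * pi * D) * (3 * D + 4) / (pi^3 * D * (D + 1)\<^sup>2 * (D + 2)^3) \<le> 0"
      using D by (simp add: divide_nonpos_nonneg mult_nonneg_nonneg)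
    also have "0 \<le> 2 / (pi\<^sup>2 * (D + 1) * (D + 2)\<^sup>2)" using D by simp
    finally show ?thesis .
  next
    case False
    have "- sin (2 * pi * D) * (3 * D + 4) \<le> 1 * (3 * D + 4)"
      using D by (intro mult_right_mono) (auto simp: minus_le_iff)
    also have "\<dots> \<le> 3 * (1 * ((D + 1) * (D + 2)))"
      using D by (simp add: algebra_simps)
    also have "\<dots> \<le> pi * (2 * D * ((D + 1) * (D + 2)))"
      using pi_gt3 False D by (intro mult_mono) auto
    finally have "- sin (2 * pi * D) * (3 * D + 4) / (pi^3 * D * (D + 1)\<^sup>2 * (D + 2)^3)
        \<le> pi * (2 * D * ((D + 1) * (D + 2))) / (pi^3 * D * (D + 1)\<^sup>2 * (D + 2)^3)"
      using D by (intro divide_right_mono) auto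
    also have "\<dots> = 2 / (pi\<^sup>2 * (D + 1) * (D + 2)\<^sup>2)"
      using D by (simp add: divide_simps) (simp add: power2_eq_square power3_eq_cube)
    finally show ?thesis .
  qed
  then show ?thesis using selberg_norm_second_difference[OF D] by simp
qed

section \<open>Asymptotics of the norm and the upper bound\<close>

lemma has_integral_snc_squared:
  assumes D: "D > 0"
  shows "((\<lambda>t. 2 * (D * snc (pi * D * t))\<^sup>2) has_integral
     ((2 * pi * D * Si (2 * pi * D) + cos (2 * pi * D) - 1) / pi\<^sup>2)) {0..1}"
proof -
  \<comment> \<open>With a = pi D t, integrating sin^2 a / a^2 by parts gives Si(2a) - sin^2 a / a;
    the form \<open>sin * snc\<close> keeps this continuous at 0.\<close>
  let ?G = "\<lambda>t. 2 * D / pi * (Si (2 * pi * D * t) - sin (pi * D * t) * snc (pi * D * t))"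
  have "((\<lambda>t. 2 * (D * snc (pi * D * t))\<^sup>2) has_integral (?G 1 - ?G 0)) {0..1}"
  proof (rule fundamental_theorem_of_calculus_interior)
    have "continuous_on UNIV Si" by (simp add: continuous_on_eq_continuous_within isCont_Si)
    then have "continuous_on {0..1} (\<lambda>t. Si (2 * pi * D * t))"
      by (rule continuous_on_compose2) (auto intro!: continuous_intros)
    then show "continuous_on {0..1} ?G" by (intro continuous_intros)
    fix t :: real assume "t \<in> {0<..<1}"
    then have t: "t > 0" by simp
    have d: "((\<lambda>t. Si (2 * pi * D * t)) has_real_derivative snc (2 * pi * D * t) * (2 * pi * D)) (at t)"
      by (rule DERIV_chain'[OF _ DERIV_Si_snc]) (auto intro!: derivative_eq_intros)
    have ds: "((\<lambda>t. sin (pi * D * t)) has_real_derivative cos (pi * D * t) * (pi * D)) (at t)"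
      by (auto intro!: derivative_eq_intros)
    have tD: "pi * D * t \<noteq> 0" using t D by simp
    have "((\<lambda>t. 2 * D / pi * (Si (2 * pi * D * t) - (sin (pi * D * t))\<^sup>2 / (pi * D * t))) has_real_derivative
       2 * D / pi * (snc (2 * pi * D * t) * (2 * pi * D) -
        (2 * sin (pi * D * t) * (cos (pi * D * t) * (pi * D)) * (pi * D * t) - (sin (pi * D * t))\<^sup>2 * (pi * D)) / (pi * D * t)\<^sup>2)) (at t)"
      using tD by (auto intro!: derivative_eq_intros d ds simp: power2_eq_square)
    moreover have "2 * D / pi * (snc (2 * pi * D * t) * (2 * pi * D) -
        (2 * sin (pi * D * t) * (cos (pi * D * t) * (pi * D)) * (pi * D * t) - (sin (pi * D * t))\<^sup>2 * (pi * D)) / (pi * D * t)\<^sup>2)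
       = 2 * (D * snc (pi * D * t))\<^sup>2"
    proof -
      define a where "a = pi * D * t"
      have a0: "a \<noteq> 0" using tD by (simp add: a_def)
      have h1: "snc (2 * pi * D * t) = sin a * cos a / a"
        using a0 sin_double[of a] by (simp add: snc_def a_def mult.assoc)
      have h2: "snc a = sin a / a" using a0 by (simp add: snc_def)
      show ?thesis unfolding h1 a_def[symmetric] h2 using a0
        by (simp add: field_simps power2_eq_square)
    qed
    ultimately have "((\<lambda>t. 2 * D / pi * (Si (2 * pi * D * t) - (sin (pi * D * t))\<^sup>2 / (pi * D * t))) has_real_derivative
       2 * (D * snc (pi * D * t))\<^sup>2) (at t)" by simp
    then have "(?G has_real_derivative 2 * (D * snc (pi * D * t))\<^sup>2) (at t)"
      by (rule has_field_derivative_transform_within_open[of _ _ _ "{0<..}"])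
         (use t D in \<open>auto simp: snc_def power2_eq_square\<close>)
    then show "(?G has_vector_derivative 2 * (D * snc (pi * D * t))\<^sup>2) (at t)"
      by (simp add: has_real_derivative_iff_has_vector_derivative)
  qed simp
  moreover have "?G 1 - ?G 0 = (2 * pi * D * Si (2 * pi * D) + cos (2 * pi * D) - 1) / pi\<^sup>2"
  proof -
    have "Si 0 = 0" using Si_neg[of 0] by simp
    moreover have "sin (pi * D) * snc (pi * D) = (1 - cos (2 * pi * D)) / (2 * pi * D)"
      using D cos_double_sin[of "pi * D"] by (simp add: snc_def field_simps power2_eq_square)
    ultimately have "?G 1 - ?G 0 = 2 * D / pi * (Si (2 * pi * D) - (1 - cos (2 * pi * D)) / (2 * pi * D))"
      by simp
    moreover have "2 * D / pi * (S - (1 - c) / (2 * pi * D)) = (2 * pi * D * S + c - 1) / pi\<^sup>2" for S c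
      using D by (simp add: field_simps power2_eq_square)
    ultimately show ?thesis by (simp only:)
  qed
  ultimately show ?thesis by (simp only:)
qed

text \<open>After expanding the square and using double angles, the terms that do not vanish are D
  and -1/pi^2 from the squared sinc, the integral of \<open>?r\<close> over pi^2, 1/3 from (1 -
  t)^2, and 1 from the \<open>Si\<close> of the cross term. Apart from D they add up to
  \<open>sieve_const\<close> in the form \<open>sieve_const_eq\<close>.\<close>

lemma selberg_norm_asymptotic:
  "((\<lambda>D. selberg_norm D - D - sieve_const) \<longlongrightarrow> 0) at_top"
proof -
  let ?w = "\<lambda>D. 2 * pi * D"
  let ?r = "\<lambda>t. (1 + J_hat t) * J_defect t"
  let ?c2 = "\<lambda>t::real. (1 - t)\<^sup>2" and ?c3 = "\<lambda>t. t * (1 - t) * J_defect t" and ?c4 = "\<lambda>t::real. 1"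
  have w: "filterlim ?w at_top at_top" by real_asymp
  have c: "continuous_on {0..1} ?r" "continuous_on {0..1} ?c2" "continuous_on {0..1} ?c3" "continuous_on {0..1} ?c4"
    by (intro continuous_intros continuous_on_J_defect continuous_on_J_hat)+
  note RC = filterlim_compose[OF Riemann_Lebesgue_cos w]
  note RS = filterlim_compose[OF Riemann_Lebesgue_sin w]
  \<comment> \<open>These are the pieces that vanish in the limit.\<close>
  let ?L = "\<lambda>D. (?w D * (Si (?w D) - pi / 2) + cos (?w D)) / pi\<^sup>2
       - integral {0..1} (\<lambda>t. ?r t * cos (?w D * t)) / pi\<^sup>2
       + integral {0..1} (\<lambda>t. ?c2 t * cos (?w D * t))
       + 2 / pi * (Si (?w D) - pi / 2)
       - 2 / pi * integral {0..1} (\<lambda>t. ?c4 t * sin (?w D * t))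
       + 2 / pi * integral {0..1} (\<lambda>t. ?c3 t * sin (?w D * t))"
  have "(?L \<longlongrightarrow> 0 / pi\<^sup>2 - 0 / pi\<^sup>2 + 0 + 2 / pi * (pi / 2 - pi / 2) - 2 / pi * 0 + 2 / pi * 0) at_top"
    by (intro tendsto_add tendsto_diff tendsto_mult tendsto_const tendsto_divide RC RS c
        filterlim_compose[OF Si_asymptotic w] filterlim_compose[OF Si_at_top w]) auto
  then have "(?L \<longlongrightarrow> 0) at_top" by simp
  moreover have "\<forall>\<^sub>F D in at_top. ?L D = selberg_norm D - D - sieve_const"
    using eventually_gt_at_top[of 0]
  proof eventually_elim
    case (elim D)
    have i: "(\<lambda>t. ?r t * cos (?w D * t)) integrable_on {0..1}" "?r integrable_on {0..1}"
      "(\<lambda>t. ?c2 t * cos (?w D * t)) integrable_on {0..1}" "(\<lambda>t. ?c4 t * sin (?w D * t)) integrable_on {0..1}"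
      "(\<lambda>t. ?c3 t * sin (?w D * t)) integrable_on {0..1}"
      by (intro integrable_continuous_interval continuous_intros c(1-3))+
    have i0: "((\<lambda>t::real. (1 - t)\<^sup>2) has_integral (- ((1 - 1)^3 / 3) - (- ((1 - 0)^3 / 3)))) {0..1}"
      by (rule fundamental_theorem_of_calculus)
         (auto intro!: derivative_eq_intros simp: has_real_derivative_iff_has_vector_derivative[symmetric])
    \<comment> \<open>Here J^2 = 1 + t^2 \<open>?r\<close> is used in the sine term and J = 1 + t^2
      \<open>J_defect\<close> in the cross term; every surviving factor t z is a sine divided by
      pi.\<close>
    have e: "2 * (selberg_hat D t)\<^sup>2 = 2 * (D * snc (pi * D * t))\<^sup>2 + (?r t - ?r t * cos (?w D * t)) / pi\<^sup>2
       + ?c2 t + ?c2 t * cos (?w D * t)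
       + 2 / pi * (?w D * snc (?w D * t)) - 2 / pi * (?c4 t * sin (?w D * t))
       + 2 / pi * (?c3 t * sin (?w D * t))" for t
    proof -
      define z where "z = D * snc (pi * D * t)"
      define C where "C = cos (pi * D * t)"
      have S: "sin (pi * D * t) = pi * t * z"
        unfolding z_def snc_mult[of "pi * D * t", symmetric] by (simp only: mult_ac)
      have wD: "?w D * t = 2 * (pi * D * t)" by simp
      have e2: "cos (?w D * t) = 2 * C\<^sup>2 - 1" "sin (?w D * t) = 2 * (pi * t * z) * C"
        unfolding wD cos_double_cos sin_double S C_def by simp_all
      have sc: "C\<^sup>2 = 1 - pi\<^sup>2 * t\<^sup>2 * z\<^sup>2"
        using sin_cos_squared_add[of "pi * D * t"] unfolding S C_def[symmetric] by (simp add: power_mult_distrib)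
      have e3: "?w D * snc (?w D * t) = 2 * pi * z * C"
      proof (cases "t = 0")
        case True then show ?thesis by (simp add: z_def C_def snc_def)
      next
        case False
        have "t * (?w D * snc (?w D * t)) = sin (?w D * t)" 
          unfolding snc_mult[of "?w D * t", symmetric] by (simp only: mult_ac)
        also have "\<dots> = t * (2 * pi * z * C)" unfolding e2 by simp
        finally show ?thesis using False by simp
      qed
      have h: "selberg_hat D t = J_hat t * z + (1 - t) * C" by (simp add: selberg_hat_def z_def C_def)
      have "2 * (selberg_hat D t)\<^sup>2 = 2 * ((J_hat t)\<^sup>2 * z\<^sup>2) + 2 * (1 - t)\<^sup>2 * C\<^sup>2 + 4 * (1 - t) * J_hat t * z * C"
        unfolding h by (simp add: power2_eq_square algebra_simps)
      also have "(J_hat t)\<^sup>2 = 1 + t\<^sup>2 * ?r t"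
        unfolding J_hat_eq by (simp add: power2_eq_square algebra_simps)
      also have "2 * ((1 + t\<^sup>2 * ?r t) * z\<^sup>2) = 2 * z\<^sup>2 + (?r t - ?r t * (2 * C\<^sup>2 - 1)) / pi\<^sup>2"
        unfolding sc by (simp add: field_simps)
      also have "4 * (1 - t) * J_hat t * z * C = 2 / pi * (2 * pi * z * C) - 2 / pi * (2 * (pi * t * z) * C)
          + 2 / pi * (?c3 t * (2 * (pi * t * z) * C))"
        unfolding J_hat_eq by (simp add: field_simps power2_eq_square)
      finally show ?thesis unfolding e2 e3 z_def[symmetric] by (simp add: algebra_simps)
    qed
    have N: "selberg_norm D = (2 * pi * D * Si (2 * pi * D) + cos (2 * pi * D) - 1) / pi\<^sup>2
       + (integral {0..1} ?r - integral {0..1} (\<lambda>t. ?r t * cos (?w D * t))) / pi\<^sup>2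
       + (- ((1 - 1)^3 / 3) - (- ((1 - 0)^3 / 3))) + integral {0..1} (\<lambda>t. ?c2 t * cos (?w D * t))
       + 2 / pi * Si (?w D) - 2 / pi * integral {0..1} (\<lambda>t. ?c4 t * sin (?w D * t))
       + 2 / pi * integral {0..1} (\<lambda>t. ?c3 t * sin (?w D * t))"
      unfolding selberg_norm_def e
      by (intro integral_unique has_integral_add has_integral_diff has_integral_mult_right has_integral_divide
         integrable_integral i i0 has_integral_snc has_integral_snc_squared elim)
    have "(2 * pi * D * (S - pi / 2) + C) / pi\<^sup>2 - I1 / pi\<^sup>2 + I2 + 2 / pi * (S - pi / 2) - 2 / pi * I4 + 2 / pi * I3
       = (2 * pi * D * S + C - 1) / pi\<^sup>2 + (I0 - I1) / pi\<^sup>2 + (- ((1 - 1)^3 / 3) - (- ((1 - 0)^3 / 3))) + I2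
         + 2 / pi * S - 2 / pi * I4 + 2 / pi * I3 - D - (4 / 3 + (I0 - 1) / pi\<^sup>2)" for S C I0 I1 I2 I3 I4
      by (simp add: field_simps power2_eq_square)
    then show ?case unfolding sieve_const_eq N by (simp only:)
  qed
  ultimately show ?thesis by (rule Lim_transform_eventually)
qed

text \<open>The increments of \<open>f\<close> decrease to 0, hence are nonnegative; so
  \<open>f\<close> increases to its limit 0 and starts at or below it.\<close>

lemma selberg_norm_le:
  assumes "D > 0"
  shows "selberg_norm D \<le> D + sieve_const"
proof -
  define f where "f k = selberg_norm (D + real k) - (D + real k) - sieve_const" for k
  have lim: "f \<longlonglongrightarrow> 0"
    unfolding f_def[abs_def]
    by (rule filterlim_compose[OF selberg_norm_asymptotic, of "\<lambda>k. D + real k"]) real_asymp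
  have "decseq (\<lambda>k. f (Suc k) - f k)"
  proof (rule decseq_SucI)
    fix k
    show "f (Suc (Suc k)) - f (Suc k) \<le> f (Suc k) - f k"
      using selberg_norm_concave[of "D + real k"] assms by (simp add: f_def add_ac)
  qed
  moreover have "(\<lambda>k. f (Suc k) - f k) \<longlonglongrightarrow> 0 - 0"
    by (intro tendsto_diff lim LIMSEQ_Suc)
  ultimately have "0 \<le> f (Suc k) - f k" for k
    using decseq_ge[of "\<lambda>k. f (Suc k) - f k" 0 k] by simp
  then have "incseq f" by (intro incseq_SucI) simp
  then have "f 0 \<le> 0" using lim by (rule incseq_le)
  then show ?thesis by (simp add: f_def)
qed

section \<open>Exponential sums over sifted sets\<close>

text \<open>The weights \<open>u\<close> absorb a shift of \<theta>, which lets the induction over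
  the prime factors of \<open>q\<close> and the shift by \<beta> in the final argument reuse one
  inequality.\<close>

definition exp_sum :: "int set \<Rightarrow> (int \<Rightarrow> complex) \<Rightarrow> real \<Rightarrow> complex" where
  "exp_sum A u \<theta> = (\<Sum>n\<in>A. u n * cis (2 * pi * \<theta> * of_int n))"

lemma exp_sum_shift: "exp_sum A (\<lambda>n. u n * cis (2 * pi * \<beta> * of_int n)) \<theta> = exp_sum A u (\<theta> + \<beta>)"
  by (simp add: exp_sum_def mult.assoc cis_mult algebra_simps)

section \<open>Orthogonality modulo \<open>p\<close> and Montgomery's inequality\<close>

lemma sum_cis_residues:
  fixes p :: nat and d :: int
  assumes "p > 0"
  shows "(\<Sum>b<p. cis (2 * pi * (real b / real p) * of_int d)) = (if int p dvd d then of_nat p else 0)"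
proof -
  define w where "w = cis (2 * pi * of_int d / real p)"
  have pow: "cis (2 * pi * (real b / real p) * of_int d) = w ^ b" for b
    unfolding w_def Complex.DeMoivre by (rule arg_cong[of _ _ cis]) (simp add: mult_ac)
  have "w ^ p = cis (2 * pi * of_int d)"
    using assms by (simp add: w_def Complex.DeMoivre)
  then have wp: "w ^ p = 1" by (simp add: cis_multiple_2pi)
  have w1: "w = 1 \<longleftrightarrow> int p dvd d"
  proof
    assume "w = 1"
    then have "cos (2 * pi * of_int d / real p) = 1" by (simp add: w_def complex_eq_iff)
    then obtain n :: int where "2 * pi * of_int d / real p = n * 2 * pi"
      unfolding cos_one_2pi_int by auto
    then have "of_int d = (of_int (n * int p) :: real)" using assms by (simp add: field_simps)
    then have "d = n * int p" unfolding of_int_eq_iff .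
    then show "int p dvd d" by simp
  next
    assume "int p dvd d"
    then obtain k where "d = int p * k" by auto
    then have "w = cis (2 * pi * of_int k)" using assms by (simp add: w_def mult_ac)
    then show "w = 1" by (simp add: cis_multiple_2pi)
  qed
  show ?thesis
  proof (cases "w = 1")
    case True
    then show ?thesis unfolding pow using w1 by simp
  next
    case False
    then have "(\<Sum>b<p. w ^ b) = 0" using geometric_sum[of w p] wp by simp
    then show ?thesis unfolding pow using False w1 by simp
  qed
qed

text \<open>Parseval's identity for the discrete Fourier transform: expand the square and sum over
  \<open>b\<close> first, which leaves only the diagonal.\<close>

lemma parseval_residues:
  fixes z :: "int \<Rightarrow> complex" and p :: nat
  assumes p: "p > 0"
  shows "(\<Sum>b<p. (cmod (\<Sum>h\<in>{0..<int p}. z h * cis (2 * pi * (real b / real p) * of_int h)))\<^sup>2)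
     = real p * (\<Sum>h\<in>{0..<int p}. (cmod (z h))\<^sup>2)"
proof -
  let ?H = "{0..<int p}" and ?c = "\<lambda>b h. cis (2 * pi * (real b / real p) * of_int h)"
  have "complex_of_real (\<Sum>b<p. (cmod (\<Sum>h\<in>?H. z h * ?c b h))\<^sup>2)
     = (\<Sum>b<p. (\<Sum>h\<in>?H. z h * ?c b h) * cnj (\<Sum>h\<in>?H. z h * ?c b h))"
    by (simp only: of_real_sum complex_norm_square)
  also have "\<dots> = (\<Sum>b<p. \<Sum>h\<in>?H. \<Sum>k\<in>?H. z h * cnj (z k) * ?c b (h - k))"
  proof (rule sum.cong[OF refl])
    fix b
    have "?c b h * cnj (?c b k) = ?c b (h - k)" for h k
      by (simp add: cis_cnj cis_mult diff_divide_distrib algebra_simps)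
    moreover have "(z h * ?c b h) * (cnj (z k) * cnj (?c b k)) = z h * cnj (z k) * (?c b h * cnj (?c b k))" for h k
      by (simp only: mult_ac)
    ultimately show "(\<Sum>h\<in>?H. z h * ?c b h) * cnj (\<Sum>h\<in>?H. z h * ?c b h) = (\<Sum>h\<in>?H. \<Sum>k\<in>?H. z h * cnj (z k) * ?c b (h - k))"
      by (simp only: sum_product cnj_sum complex_cnj_mult)
  qed
  also have "\<dots> = (\<Sum>h\<in>?H. \<Sum>b<p. \<Sum>k\<in>?H. z h * cnj (z k) * ?c b (h - k))"
    by (rule sum.swap)
  also have "\<dots> = (\<Sum>h\<in>?H. \<Sum>k\<in>?H. z h * cnj (z k) * (\<Sum>b<p. ?c b (h - k)))"
    by (subst sum.swap) (simp only: sum_distrib_left)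
  also have "\<dots> = (\<Sum>h\<in>?H. \<Sum>k\<in>?H. if k = h then z h * cnj (z k) * of_nat p else 0)"
  proof (intro sum.cong refl)
    fix h k assume hk: "h \<in> ?H" "k \<in> ?H"
    have "int p dvd h - k \<longleftrightarrow> k = h"
      using hk by (auto simp: mod_eq_dvd_iff[symmetric])
    then show "z h * cnj (z k) * (\<Sum>b<p. ?c b (h - k)) = (if k = h then z h * cnj (z k) * of_nat p else 0)"
      unfolding sum_cis_residues[OF p] by simp
  qed
  also have "\<dots> = (\<Sum>h\<in>?H. z h * cnj (z h) * of_nat p)"
    by (intro sum.cong refl) (simp add: sum.delta')
  also have "\<dots> = complex_of_real (real p * (\<Sum>h\<in>?H. (cmod (z h))\<^sup>2))"
    by (simp only: of_real_mult of_real_sum complex_norm_square of_real_of_nat_eq sum_distrib_left mult.commute)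
  finally show ?thesis unfolding of_real_eq_iff .
qed

text \<open>Group \<open>A\<close> by residue classes. The classes in \<open>L\<close> are empty, so
  Cauchy-Schwarz over the other p - |L| classes bounds the value at 0, and Parseval evaluates the
  sum over all \<open>b\<close>.\<close>

lemma montgomery_prime:
  fixes A L :: "int set" and p :: nat
  assumes A: "finite A" "\<And>n. n \<in> A \<Longrightarrow> n mod int p \<notin> L" and p: "p > 0" and L: "L \<subset> {0..<int p}"
  shows "real (card L) / (real p - real (card L)) * (cmod (exp_sum A u 0))\<^sup>2
     \<le> (\<Sum>b\<in>{1..<p}. (cmod (exp_sum A u (real b / real p)))\<^sup>2)"
proof -
  let ?H = "{0..<int p}"
  define z where "z h = (\<Sum>n\<in>{n \<in> A. n mod int p = h}. u n)" for h
  have E: "exp_sum A u (real b / real p) = (\<Sum>h\<in>?H. z h * cis (2 * pi * (real b / real p) * of_int h))" for b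
  proof -
    have c: "cis (2 * pi * (real b / real p) * of_int n) = cis (2 * pi * (real b / real p) * of_int (n mod int p))" for n :: int
    proof -
      have "n = int p * (n div int p) + n mod int p" by simp
      then have "of_int n = real p * of_int (n div int p) + (of_int (n mod int p) :: real)"
        by (metis of_int_add of_int_mult of_int_of_nat_eq)
      then have "2 * pi * (real b / real p) * of_int n = 2 * pi * of_int (int b * (n div int p)) + 2 * pi * (real b / real p) * of_int (n mod int p)"
        using p by (simp add: field_simps)
      then have "cis (2 * pi * (real b / real p) * of_int n) = cis (2 * pi * of_int (int b * (n div int p))) * cis (2 * pi * (real b / real p) * of_int (n mod int p))"
        by (simp only: cis_mult)
      then show ?thesis by (simp only: cis_multiple_2pi Ints_of_int mult_1)
    qed
    have "exp_sum A u (real b / real p) = (\<Sum>h\<in>?H. \<Sum>n\<in>{n \<in> A. n mod int p = h}. u n * cis (2 * pi * (real b / real p) * of_int n))"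
      unfolding exp_sum_def by (rule sum.group[symmetric]) (use A p in auto)
    also have "\<dots> = (\<Sum>h\<in>?H. z h * cis (2 * pi * (real b / real p) * of_int h))"
      unfolding z_def sum_distrib_right
    proof (intro sum.cong refl)
      fix h n assume "n \<in> {n \<in> A. n mod int p = h}"
      then show "u n * cis (2 * pi * (real b / real p) * of_int n) = u n * cis (2 * pi * (real b / real p) * of_int h)"
        using c[of n] by simp
    qed
    finally show ?thesis .
  qed
  have fL: "finite L" using L finite_subset[of L ?H] by auto
  have cL: "card L < p"
    using psubset_card_mono[OF _ L] by simp
  let ?S = "\<Sum>h\<in>?H. (cmod (z h))\<^sup>2"
  have zL: "z h = 0" if "h \<in> L" for h
  proof -
    have "{n \<in> A. n mod int p = h} = {}" using A(2) that by auto
    then show ?thesis by (simp only: z_def sum.empty)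
  qed
  have cs: "(cmod (exp_sum A u 0))\<^sup>2 \<le> (real p - real (card L)) * ?S"
  proof -
    have "exp_sum A u 0 = (\<Sum>h\<in>?H. z h)" using E[of 0] by simp
    also have "\<dots> = (\<Sum>h\<in>?H - L. z h)"
      by (rule sum.mono_neutral_right) (auto simp: zL)
    finally have "cmod (exp_sum A u 0) \<le> (\<Sum>h\<in>?H - L. 1 * cmod (z h))"
      using norm_sum[of z "?H - L"] by simp
    then have "(cmod (exp_sum A u 0))\<^sup>2 \<le> (\<Sum>h\<in>?H - L. 1 * cmod (z h))\<^sup>2"
      by (intro power_mono) auto
    also have "\<dots> \<le> (\<Sum>h\<in>?H - L. 1\<^sup>2) * (\<Sum>h\<in>?H - L. (cmod (z h))\<^sup>2)"
      by (rule Cauchy_Schwarz_ineq_sum)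
    also have "(\<Sum>h\<in>?H - L. 1\<^sup>2) = real p - real (card L)"
      using L fL cL by (simp add: card_Diff_subset of_nat_diff)
    also have "(\<Sum>h\<in>?H - L. (cmod (z h))\<^sup>2) = ?S"
      by (rule sum.mono_neutral_left) (auto simp: zL)
    finally show ?thesis .
  qed
  have "(\<Sum>b<p. (cmod (exp_sum A u (real b / real p)))\<^sup>2) = real p * ?S"
    unfolding E by (rule parseval_residues[OF p])
  moreover have "{..<p} = insert 0 {1..<p}" using p by auto
  ultimately have tot: "(\<Sum>b\<in>{1..<p}. (cmod (exp_sum A u (real b / real p)))\<^sup>2) = real p * ?S - (cmod (exp_sum A u 0))\<^sup>2"
    by simp
  \<comment> \<open>The factor |L| / (p - |L|) is p / (p - |L|) - 1, and the -1 matches the term b =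
    0 removed from the full sum.\<close>
  have "real (card L) / (real p - real (card L)) * (cmod (exp_sum A u 0))\<^sup>2
    = real p * ((cmod (exp_sum A u 0))\<^sup>2 / (real p - real (card L))) - (cmod (exp_sum A u 0))\<^sup>2"
    using cL by (simp add: field_simps)
  also have "(cmod (exp_sum A u 0))\<^sup>2 / (real p - real (card L)) \<le> ?S"
    using cs cL by (simp add: field_simps)
  finally show ?thesis unfolding tot by (simp add: mult_left_mono)
qed

text \<open>Induction on \<open>q\<close> = p r. The prime case produces the fractions b/p, and the
  induction hypothesis, applied to the weights twisted by b/p, adds the fractions c/r. By the
  Chinese remainder theorem the sums b/p + c/r are reduced fractions modulo
  \<open>q\<close>.\<close>

lemma montgomery_squarefree:
  fixes A :: "int set" and L :: "nat \<Rightarrow> int set"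
  assumes A: "finite A"
  shows "squarefree q \<Longrightarrow> (\<And>p. p \<in> prime_factors q \<Longrightarrow> L p \<subset> {0..<int p} \<and> (\<forall>n\<in>A. n mod int p \<notin> L p)) \<Longrightarrow>
     (\<Prod>p\<in>prime_factors q. real (card (L p)) / (real p - real (card (L p)))) * (cmod (exp_sum A u 0))\<^sup>2
      \<le> (\<Sum>a\<in>totatives q. (cmod (exp_sum A u (real a / real q)))\<^sup>2)"
proof (induction q arbitrary: u rule: less_induct)
  case (less q)
  let ?g = "\<lambda>q. \<Prod>p\<in>prime_factors q. real (card (L p)) / (real p - real (card (L p)))"
  show ?case
  proof (cases "q = 1")
    case True
    \<comment> \<open>The only totative of 1 is 1 itself, so the right-hand side is the value at 1
      and periodicity is needed.\<close>
    have "exp_sum A u 1 = exp_sum A u 0"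
      unfolding exp_sum_def by (intro sum.cong refl) (simp add: cis_multiple_2pi)
    then show ?thesis using True by simp
  next
    case False
    have q0: "q \<noteq> 0" using less.prems(1) by (auto intro: ccontr)
    then obtain p where p: "prime p" "p dvd q" using False prime_factor_nat by blast
    then obtain r where q: "q = p * r" by auto
    have "\<not> p dvd r"
    proof
      assume "p dvd r"
      then have "p\<^sup>2 dvd q" unfolding q power2_eq_square by (rule mult_dvd_mono[OF dvd_refl])
      then show False using less.prems(1) p(1) by (auto simp: squarefree_def)
    qed
    then have cop: "coprime p r" using p(1) prime_imp_coprime by blast
    have p1: "p > 1" using p prime_gt_1_nat by simp
    have r0: "r > 0" using q q0 by auto
    have r_less: "r < q" using p1 r0 q by simp
    have pf: "prime_factors q = insert p (prime_factors r)" and pnr: "p \<notin> prime_factors r"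
      using p r0 p1 cop by (auto simp: q prime_factors_product prime_prime_factors coprime_absorb_left)
    have sr: "squarefree r" using less.prems(1) unfolding q by (rule squarefree_multD)
    have Lp: "L p \<subset> {0..<int p}" "\<And>n. n \<in> A \<Longrightarrow> n mod int p \<notin> L p"
      using less.prems(2)[of p] pf by auto
    \<comment> \<open>\<open>\<phi> (b, c)\<close> is the numerator of b/p + c/r reduced modulo 1.
      All terms are nonnegative, so injectivity into the totatives is enough.\<close>
    define \<phi> where "\<phi> = (\<lambda>(b, c). (b * r + c * p) mod q)"
    let ?P = "{1..<p} \<times> totatives r"
    have cong: "[\<phi> (b, c) = b * r] (mod p)" "[\<phi> (b, c) = c * p] (mod r)" for b c
      unfolding \<phi>_def q by (auto simp: cong_def mod_mult_self1 mod_mod_cancel)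
    have inj: "inj_on \<phi> ?P"
    proof (rule inj_onI, clarify)
      fix b c b' c'
      assume b: "b \<in> {1..<p}" "b' \<in> {1..<p}" and c: "c \<in> totatives r" "c' \<in> totatives r" and eq: "\<phi> (b, c) = \<phi> (b', c')"
      have "[b * r = b' * r] (mod p)" using cong(1)[of b c] cong(1)[of b' c'] eq by (metis cong_sym cong_trans)
      then have "[b = b'] (mod p)" using cop by (metis cong_mult_rcancel_nat coprime_commute)
      then have "b = b'" using b by (auto simp: cong_def)
      have "[c * p = c' * p] (mod r)" using cong(2)[of b c] cong(2)[of b' c'] eq by (metis cong_sym cong_trans)
      then have cc: "[c = c'] (mod r)" using cop by (metis cong_mult_rcancel_nat)
      have "c = c'"
      \<comment> \<open>For r = 1 the totative is 1 and not below \<open>r\<close>, so the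
        congruence cannot be read as equality of residues.\<close>
      proof (cases "r = 1")
        case True then show ?thesis using c by simp
      next
        case False
        then have "c < r" "c' < r" using c totatives_less r0 by auto
        then show ?thesis using cc by (auto simp: cong_def)
      qed
      then show "b = b' \<and> c = c'" using \<open>b = b'\<close> by simp
    qed
    have img: "\<phi> ` ?P \<subseteq> totatives q"
    proof (rule image_subsetI, clarify)
      fix b c assume b: "b \<in> {1..<p}" and c: "c \<in> totatives r"
      have "\<not> p dvd b" using b by (auto dest: dvd_imp_le)
      then have "coprime b p" using p prime_imp_coprime coprime_commute by blast
      then have "coprime (b * r) p" using cop by (simp add: coprime_commute)
      then have 1: "coprime (\<phi> (b, c)) p" using cong(1) cong_imp_coprime cong_sym by blast
      have "coprime (c * p) r" using c cop by (simp add: in_totatives_iff)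
      then have 2: "coprime (\<phi> (b, c)) r" using cong(2) cong_imp_coprime cong_sym by blast
      have 3: "coprime (\<phi> (b, c)) q" unfolding q using 1 2 by simp
      moreover have "\<phi> (b, c) < q" using q0 by (simp add: \<phi>_def)
      moreover have "\<phi> (b, c) \<noteq> 0" using 3 False by (auto intro: ccontr)
      ultimately show "\<phi> (b, c) \<in> totatives q" by (simp add: in_totatives_iff)
    qed
    have Ephi: "exp_sum A u (real (\<phi> (b, c)) / real q) = exp_sum A (\<lambda>n. u n * cis (2 * pi * (real b / real p) * of_int n)) (real c / real r)" for b c
    proof -
      define k where "k = (b * r + c * p) div q"
      have "b * r + c * p = k * q + \<phi> (b, c)" by (simp add: k_def \<phi>_def)
      then have "real b * real r + real c * real p = real k * real q + real (\<phi> (b, c))"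
        by (metis of_nat_add of_nat_mult)
      then have "real (\<phi> (b, c)) / real q = real c / real r + real b / real p - real k"
        using p1 r0 unfolding q by (simp add: field_simps)
      then have ang: "real (\<phi> (b, c)) / real q + real k = real c / real r + real b / real p" by simp
      have "exp_sum A u (real (\<phi> (b, c)) / real q) = exp_sum A u (real (\<phi> (b, c)) / real q + real k)"
        unfolding exp_sum_def
      proof (intro sum.cong refl)
        fix n
        have "2 * pi * (real (\<phi> (b, c)) / real q + real k) * of_int n = 2 * pi * (real (\<phi> (b, c)) / real q) * of_int n + 2 * pi * of_int (int k * n)"
          by (simp add: algebra_simps)
        then have "cis (2 * pi * (real (\<phi> (b, c)) / real q + real k) * of_int n) = cis (2 * pi * (real (\<phi> (b, c)) / real q) * of_int n) * cis (2 * pi * of_int (int k * n))"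
          by (simp only: cis_mult)
        then show "u n * cis (2 * pi * (real (\<phi> (b, c)) / real q) * of_int n) = u n * cis (2 * pi * (real (\<phi> (b, c)) / real q + real k) * of_int n)"
          by (simp only: cis_multiple_2pi Ints_of_int mult_1_right)
      qed
      then show ?thesis unfolding exp_sum_shift ang .
    qed
    have gr: "?g r \<ge> 0"
    proof (rule prod_nonneg)
      fix p' assume "p' \<in> prime_factors r"
      then have "L p' \<subset> {0..<int p'}" using less.prems(2)[of p'] pf by auto
      then have "card (L p') < p'" using psubset_card_mono[of "{0..<int p'}" "L p'"] by simp
      then show "real (card (L p')) / (real p' - real (card (L p'))) \<ge> 0" by simp
    qed
    have gq: "?g q = ?g r * (real (card (L p)) / (real p - real (card (L p))))"
      unfolding pf using pnr by simp
    have "?g q * (cmod (exp_sum A u 0))\<^sup>2 \<le> ?g r * (\<Sum>b\<in>{1..<p}. (cmod (exp_sum A u (real b / real p)))\<^sup>2)"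
      unfolding gq mult.assoc
      by (rule mult_left_mono[OF montgomery_prime[OF A Lp(2) _ Lp(1)] gr]) (use p1 in auto)
    also have "\<dots> = (\<Sum>b\<in>{1..<p}. ?g r * (cmod (exp_sum A (\<lambda>n. u n * cis (2 * pi * (real b / real p) * of_int n)) 0))\<^sup>2)"
      by (simp only: sum_distrib_left exp_sum_shift add_0)
    also have "\<dots> \<le> (\<Sum>b\<in>{1..<p}. \<Sum>c\<in>totatives r. (cmod (exp_sum A (\<lambda>n. u n * cis (2 * pi * (real b / real p) * of_int n)) (real c / real r)))\<^sup>2)"
      by (rule sum_mono, rule less.IH[OF r_less sr], rule less.prems(2)) (use pf in auto)
    also have "\<dots> = (\<Sum>x\<in>?P. (cmod (exp_sum A u (real (\<phi> x) / real q)))\<^sup>2)"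
      unfolding sum.cartesian_product by (intro sum.cong refl) (auto simp: Ephi)
    also have "\<dots> = (\<Sum>a\<in>\<phi> ` ?P. (cmod (exp_sum A u (real a / real q)))\<^sup>2)"
      unfolding sum.reindex[OF inj] by (simp only: comp_def)
    also have "\<dots> \<le> (\<Sum>a\<in>totatives q. (cmod (exp_sum A u (real a / real q)))\<^sup>2)"
      by (rule sum_mono2) (use img in auto)
    finally show ?thesis .
  qed
qed

section \<open>The local inequality and the arcs\<close>

text \<open>The integral of (f - c g)^2 is a nonnegative quadratic in \<open>c\<close>, evaluated at
  its minimum \<open>?Z / ?Y\<close>.\<close>

lemma integral_Cauchy_Schwarz:
  fixes f g :: "real \<Rightarrow> real"
  assumes f: "continuous_on {a..b} f" and g: "continuous_on {a..b} g"
  shows "(integral {a..b} (\<lambda>t. f t * g t))\<^sup>2 \<le> integral {a..b} (\<lambda>t. (f t)\<^sup>2) * integral {a..b} (\<lambda>t. (g t)\<^sup>2)"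
proof -
  let ?X = "integral {a..b} (\<lambda>t. (f t)\<^sup>2)" and ?Y = "integral {a..b} (\<lambda>t. (g t)\<^sup>2)"
    and ?Z = "integral {a..b} (\<lambda>t. f t * g t)"
  have i: "(\<lambda>t. (f t)\<^sup>2) integrable_on {a..b}" "(\<lambda>t. (g t)\<^sup>2) integrable_on {a..b}"
    "(\<lambda>t. f t * g t) integrable_on {a..b}"
    by (intro integrable_continuous_interval continuous_intros f g)+
  have Y0: "?Y \<ge> 0" by (intro integral_nonneg i) auto
  have q: "0 \<le> ?X - 2 * c * ?Z + c\<^sup>2 * ?Y" for c
  proof -
    have "((\<lambda>t. (f t)\<^sup>2 - 2 * c * (f t * g t) + c\<^sup>2 * (g t)\<^sup>2) has_integral (?X - 2 * c * ?Z + c\<^sup>2 * ?Y)) {a..b}"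
      by (intro has_integral_add has_integral_diff has_integral_mult_right integrable_integral i)
    moreover have "(f t)\<^sup>2 - 2 * c * (f t * g t) + c\<^sup>2 * (g t)\<^sup>2 = (f t - c * g t)\<^sup>2" for t
      by (simp add: power2_eq_square algebra_simps)
    ultimately show ?thesis by (auto intro: has_integral_nonneg)
  qed
  show ?thesis
  proof (cases "?Y = 0")
    case True
    have "?Z = 0"
    proof (rule ccontr)
      assume "?Z \<noteq> 0"
      \<comment> \<open>With \<open>?Y\<close> = 0 the quadratic is linear in \<open>c\<close>, and
        this value of \<open>c\<close> makes it -1.\<close>
      then show False using q[of "(?X + 1) / (2 * ?Z)"] True by simp
    qed
    then show ?thesis using True by simp
  next
    case False
    then have "0 \<le> ?X - ?Z\<^sup>2 / ?Y"
      using q[of "?Z / ?Y"] by (simp add: power2_eq_square field_simps)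
    then show ?thesis using False Y0 by (simp add: field_simps)
  qed
qed

text \<open>The majorant is at least 1 at x = 0, which by Cauchy-Schwarz is impossible for a
  vanishing norm. This later yields positive weights in the sieve sum.\<close>

lemma selberg_norm_pos:
  assumes "D > 0"
  shows "selberg_norm D > 0"
proof -
  let ?I = "integral {0..1} (\<lambda>t. 2 * selberg_hat D t * cos (pi * (2 * 0 - D) * t))"
  let ?J = "integral {0..1} (\<lambda>t. (sqrt 2 * cos (pi * (2 * 0 - D) * t))\<^sup>2)"
  have "?I = integral {0..1} (\<lambda>t. (sqrt 2 * selberg_hat D t) * (sqrt 2 * cos (pi * (2 * 0 - D) * t)))"
    by (intro integral_cong) (simp add: algebra_simps)
  then have "?I\<^sup>2 \<le> integral {0..1} (\<lambda>t. (sqrt 2 * selberg_hat D t)\<^sup>2) * ?J"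
    by (simp only:) (intro integral_Cauchy_Schwarz continuous_intros continuous_on_selberg_hat)
  also have "integral {0..1} (\<lambda>t. (sqrt 2 * selberg_hat D t)\<^sup>2) = selberg_norm D"
    unfolding selberg_norm_def by (simp add: power_mult_distrib)
  finally have "?I\<^sup>2 \<le> selberg_norm D * ?J" .
  moreover have "1\<^sup>2 \<le> ?I\<^sup>2"
    by (intro power_mono selberg_majorant) (use assms in auto)
  moreover have "selberg_norm D \<ge> 0"
    unfolding selberg_norm_def
    by (intro integral_nonneg integrable_continuous_interval continuous_intros continuous_on_selberg_hat) auto
  ultimately show ?thesis by (cases "selberg_norm D = 0") auto
qed

abbreviation expsum1 :: "int set \<Rightarrow> real \<Rightarrow> complex" where
  "expsum1 A \<equiv> exp_sum A (\<lambda>_. 1)"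

lemma continuous_on_exp_sum [continuous_intros]:
  "continuous_on S f \<Longrightarrow> continuous_on S (\<lambda>x. exp_sum A u (f x))"
  unfolding exp_sum_def by (intro continuous_intros)

lemma sum_cos_le_cmod_exp_sum:
  "(\<Sum>n\<in>A. cos (2 * pi * \<theta> * of_int n - \<phi>)) \<le> cmod (expsum1 A \<theta>)"
proof -
  have "(\<Sum>n\<in>A. cos (2 * pi * \<theta> * of_int n - \<phi>)) = Re (expsum1 A \<theta> * cis (- \<phi>))"
    by (simp add: exp_sum_def sum_distrib_right cis_mult)
  also have "\<dots> \<le> cmod (expsum1 A \<theta> * cis (- \<phi>))" by (rule complex_Re_le_cmod)
  also have "\<dots> = cmod (expsum1 A \<theta>)" by (simp add: norm_mult)
  finally show ?thesis .
qed

lemma cmod_expsum1_squared: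
  "(cmod (expsum1 A \<theta>))\<^sup>2 = (\<Sum>n\<in>A. \<Sum>m\<in>A. cos (2 * pi * of_int (n - m) * \<theta>))"
proof -
  have "(cmod (expsum1 A \<theta>))\<^sup>2 = Re (expsum1 A \<theta> * cnj (expsum1 A \<theta>))"
    by (metis Re_complex_of_real complex_norm_square)
  also have "\<dots> = (\<Sum>n\<in>A. \<Sum>m\<in>A. cos (2 * pi * of_int (n - m) * \<theta>))"
    by (simp add: exp_sum_def sum_product cnj_sum cis_cnj cis_mult Re_sum algebra_simps)
  finally show ?thesis .
qed

lemma has_integral_cmod_expsum1_period:
  assumes "finite A"
  shows "((\<lambda>\<theta>. (cmod (expsum1 A \<theta>))\<^sup>2) has_integral real (card A)) {s..s+1}"
proof -
  have c: "((\<lambda>\<theta>. cos (2 * pi * of_int (n - m) * \<theta>)) has_integral (if m = n then 1 else 0)) {s..s+1}" for n m :: int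
  proof (cases "m = n")
    case True
    then show ?thesis using has_integral_const_real[of "1::real" s "s+1"] by simp
  next
    case False
    define a where "a = 2 * pi * real_of_int (n - m)"
    have a: "a \<noteq> 0" using False by (simp add: a_def)
    have "((\<lambda>\<theta>. cos (a * \<theta>)) has_integral (sin (a * (s + 1)) / a - sin (a * s) / a)) {s..s+1}"
      by (rule fundamental_theorem_of_calculus)
         (use a in \<open>auto intro!: derivative_eq_intros simp: has_real_derivative_iff_has_vector_derivative[symmetric]\<close>)
    moreover have "sin (a * (s + 1)) = sin (a * s)"
    proof -
      have "cos a = 1" "sin a = 0"
        using cos_int_2pin[of "n - m"] sin_int_2pin[of "n - m"] by (simp_all only: a_def)
      then show ?thesis by (simp add: distrib_left sin_add)
    qed
    ultimately show ?thesis using False by (simp add: a_def)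
  qed
  have "((\<lambda>\<theta>. \<Sum>n\<in>A. \<Sum>m\<in>A. cos (2 * pi * of_int (n - m) * \<theta>)) has_integral (\<Sum>n\<in>A. \<Sum>m\<in>A. if m = n then 1 else 0)) {s..s+1}"
    by (intro has_integral_sum assms c)
  then show ?thesis using assms by (simp add: cmod_expsum1_squared)
qed

lemma cmod_expsum1_minus: "(cmod (expsum1 A (- \<theta>)))\<^sup>2 = (cmod (expsum1 A \<theta>))\<^sup>2"
  by (simp add: cmod_expsum1_squared)

lemma integral_even_scaled:
  fixes f :: "real \<Rightarrow> real"
  assumes f: "continuous_on {-\<eta>..\<eta>} f" and even: "\<And>x. f (- x) = f x" and \<eta>: "\<eta> > 0"
  shows "integral {-\<eta>..\<eta>} f = \<eta> * integral {0..1} (\<lambda>t. 2 * f (\<eta> * t))"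
proof -
  have i: "f integrable_on {-\<eta>..\<eta>}" by (rule integrable_continuous_interval[OF f])
  have "integral {-\<eta>..\<eta>} f = integral {-\<eta>..0} f + integral {0..\<eta>} f"
    using \<eta> i by (intro Henstock_Kurzweil_Integration.integral_combine[symmetric]) auto
  also have "integral {-\<eta>..0} f = integral {0..\<eta>} f"
    using Henstock_Kurzweil_Integration.integral_reflect_real[of \<eta> 0 f] even by simp
  finally have 1: "integral {-\<eta>..\<eta>} f = 2 * integral {0..\<eta>} f" by simp
  have "(f has_integral integral {0..\<eta>} f) {0..\<eta>}"
    using integrable_on_subinterval[OF i, of 0 \<eta>] \<eta> by (simp add: integrable_integral)
  from has_integral_stretch_real[OF this, of \<eta>] \<eta>
  have "((\<lambda>t. f (\<eta> * t)) has_integral (1 / \<eta>) * integral {0..\<eta>} f) ((\<lambda>x. x / \<eta>) ` {0..\<eta>})" by simp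
  moreover have "(\<lambda>x. x / \<eta>) ` {0..\<eta>} = {0..1}"
    using \<eta> by (simp add: image_divide_atLeastAtMost)
  ultimately have "((\<lambda>t. 2 * f (\<eta> * t)) has_integral 2 * ((1 / \<eta>) * integral {0..\<eta>} f)) {0..1}"
    by (intro has_integral_mult_right) simp
  then have 2: "integral {0..1} (\<lambda>t. 2 * f (\<eta> * t)) = 2 * ((1 / \<eta>) * integral {0..\<eta>} f)"
    by (rule integral_unique)
  show ?thesis unfolding 1 2 using \<eta> by simp
qed

text \<open>Scaling n - M by \<eta> maps \<open>A\<close> into [0, D]. Summing the majorant over
  \<open>A\<close> and exchanging sum and integral leaves \<open>selberg_hat\<close> against a
  cosine sum bounded by the modulus of the exponential sum; Cauchy-Schwarz then separates the
  two.\<close>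

lemma card_squared_le_local_integral:
  fixes M N :: int
  assumes A: "finite A" "A \<subseteq> {M..M + N}" and N: "N \<ge> 1" and \<eta>: "\<eta> > 0"
  shows "(real (card A))\<^sup>2 \<le> (of_int N + sieve_const / \<eta>) * integral {-\<eta>..\<eta>} (\<lambda>\<beta>. (cmod (expsum1 A \<beta>))\<^sup>2)"
proof -
  define D where "D = \<eta> * of_int N"
  have D: "D > 0" using N \<eta> by (simp add: D_def)
  let ?c = "\<lambda>n t. cos (pi * (2 * (\<eta> * of_int (n - M)) - D) * t)"
  let ?T = "\<lambda>t. cmod (expsum1 A (\<eta> * t))"
  have int: "(\<lambda>t. 2 * selberg_hat D t * ?c n t) integrable_on {0..1}" for n
    by (intro integrable_continuous_interval continuous_intros continuous_on_selberg_hat)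
  have "real (card A) = (\<Sum>n\<in>A. 1)" by simp
  also have "\<dots> \<le> (\<Sum>n\<in>A. integral {0..1} (\<lambda>t. 2 * selberg_hat D t * ?c n t))"
    by (intro sum_mono selberg_majorant) (use A \<eta> in \<open>auto simp: D_def\<close>)
  also have "\<dots> = integral {0..1} (\<lambda>t. \<Sum>n\<in>A. 2 * selberg_hat D t * ?c n t)"
    by (rule integral_sum[symmetric, OF A(1) int])
  \<comment> \<open>The factor 2 is shared between the two factors, so that each square again
    represents an integral over a symmetric interval.\<close>
  also have "\<dots> \<le> integral {0..1} (\<lambda>t. (sqrt 2 * \<bar>selberg_hat D t\<bar>) * (sqrt 2 * ?T t))"
  proof (rule integral_le)
    show "(\<lambda>t. \<Sum>n\<in>A. 2 * selberg_hat D t * ?c n t) integrable_on {0..1}"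
      by (intro integrable_sum A int)
    show "(\<lambda>t. (sqrt 2 * \<bar>selberg_hat D t\<bar>) * (sqrt 2 * ?T t)) integrable_on {0..1}"
      by (intro integrable_continuous_interval continuous_intros continuous_on_selberg_hat)
    fix t :: real
    define \<phi> where "\<phi> = pi * (2 * \<eta> * of_int M + D) * t"
    have ang: "pi * (2 * (\<eta> * of_int (n - M)) - D) * t = 2 * pi * (\<eta> * t) * of_int n - \<phi>" for n
      by (simp add: \<phi>_def algebra_simps)
    have ang': "2 * pi * (\<eta> * t) * of_int n - \<phi> + pi = 2 * pi * (\<eta> * t) * of_int n - (\<phi> - pi)" for n by simp
    have "(\<Sum>n\<in>A. ?c n t) \<le> ?T t"
      unfolding ang by (rule sum_cos_le_cmod_exp_sum)
    \<comment> \<open>Moving the phase by pi reverses the sign of every cosine.\<close>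
    moreover have "- (\<Sum>n\<in>A. ?c n t) \<le> ?T t"
      using sum_cos_le_cmod_exp_sum[where A = A and \<theta> = "\<eta> * t" and \<phi> = "\<phi> - pi"]
      unfolding ang ang'[symmetric] by (simp add: sum_negf)
    ultimately have "\<bar>\<Sum>n\<in>A. ?c n t\<bar> \<le> ?T t" by linarith
    then have "\<bar>selberg_hat D t\<bar> * \<bar>\<Sum>n\<in>A. ?c n t\<bar> \<le> \<bar>selberg_hat D t\<bar> * ?T t"
      by (rule mult_left_mono) simp
    then have "selberg_hat D t * (\<Sum>n\<in>A. ?c n t) \<le> \<bar>selberg_hat D t\<bar> * ?T t"
      unfolding abs_mult[symmetric] by linarith
    then have "2 * selberg_hat D t * (\<Sum>n\<in>A. ?c n t) \<le> (sqrt 2 * sqrt 2) * (\<bar>selberg_hat D t\<bar> * ?T t)"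
      by simp
    also have "\<dots> = (sqrt 2 * \<bar>selberg_hat D t\<bar>) * (sqrt 2 * ?T t)"
      by (simp only: mult_ac)
    finally show "(\<Sum>n\<in>A. 2 * selberg_hat D t * ?c n t) \<le> (sqrt 2 * \<bar>selberg_hat D t\<bar>) * (sqrt 2 * ?T t)"
      by (simp only: sum_distrib_left)
  qed
  finally have "(real (card A))\<^sup>2 \<le> (integral {0..1} (\<lambda>t. (sqrt 2 * \<bar>selberg_hat D t\<bar>) * (sqrt 2 * ?T t)))\<^sup>2"
    by (rule power_mono) simp
  also have "\<dots> \<le> integral {0..1} (\<lambda>t. (sqrt 2 * \<bar>selberg_hat D t\<bar>)\<^sup>2) * integral {0..1} (\<lambda>t. (sqrt 2 * ?T t)\<^sup>2)"
    by (intro integral_Cauchy_Schwarz continuous_intros continuous_on_selberg_hat)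
  also have "\<dots> = selberg_norm D * integral {0..1} (\<lambda>t. 2 * (?T t)\<^sup>2)"
    by (simp add: selberg_norm_def power_mult_distrib)
  also have "\<dots> \<le> (D + sieve_const) * integral {0..1} (\<lambda>t. 2 * (?T t)\<^sup>2)"
    by (intro mult_right_mono selberg_norm_le[OF D] integral_nonneg integrable_continuous_interval continuous_intros) auto
  also have "\<dots> = (of_int N + sieve_const / \<eta>) * (\<eta> * integral {0..1} (\<lambda>t. 2 * (?T t)\<^sup>2))"
    using \<eta> by (simp add: D_def field_simps)
  also have "\<eta> * integral {0..1} (\<lambda>t. 2 * (?T t)\<^sup>2) = integral {-\<eta>..\<eta>} (\<lambda>\<beta>. (cmod (expsum1 A \<beta>))\<^sup>2)"
    by (rule integral_even_scaled[symmetric]) (use \<eta> cmod_expsum1_minus in \<open>auto intro!: continuous_intros\<close>)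
  finally show ?thesis .
qed

section \<open>Disjoint arcs around the reduced fractions\<close>

definition arc_radius :: "real \<Rightarrow> nat \<Rightarrow> real" where
  "arc_radius Q q = 1 / (real q * (real q + Q))"

text \<open>Multiplied by q r, the left side is r/(q + Q) + q/(r + Q). Replacing \<open>Q\<close> by
  the smaller \<open>r\<close> and \<open>q\<close> respectively gives r/(q + r) + q/(q + r) =
  1.\<close>

lemma arc_radius_add_le:
  assumes "q \<ge> 1" "r \<ge> 1" "real q \<le> Q" "real r \<le> Q"
  shows "arc_radius Q q + arc_radius Q r \<le> 1 / (real q * real r)"
proof -
  have pos: "real q > 0" "real r > 0" "Q > 0" using assms by auto
  have "real r / (real q + Q) \<le> real r / (real q + real r)" "real q / (real r + Q) \<le> real q / (real q + real r)"
    using assms pos by (auto intro!: divide_left_mono)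
  moreover have "real r / (real q + real r) + real q / (real q + real r) = 1"
    using pos by (simp add: add_divide_distrib[symmetric])
  ultimately have "real r / (real q + Q) + real q / (real r + Q) \<le> 1" by linarith
  then have "(real r / (real q + Q) + real q / (real r + Q)) / (real q * real r) \<le> 1 / (real q * real r)"
    using pos by (intro divide_right_mono) auto
  moreover have "(real r / (real q + Q) + real q / (real r + Q)) / (real q * real r) = arc_radius Q q + arc_radius Q r"
    using pos by (simp add: arc_radius_def add_divide_distrib mult_ac)
  ultimately show ?thesis by simp
qed

lemma fractions_distance:
  fixes a b q r :: nat
  assumes "q \<ge> 1" "r \<ge> 1" "a * r \<noteq> b * q"
  shows "1 / (real q * real r) \<le> \<bar>real a / real q - real b / real r\<bar>"
proof -
  have "real a / real q - real b / real r = (real_of_int (int a * int r - int b * int q)) / (real q * real r)"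
    using assms by (simp add: field_simps)
  moreover have "int a * int r - int b * int q \<noteq> 0"
    using assms(3) by (metis of_nat_mult of_nat_eq_iff right_minus_eq)
  then have "1 \<le> \<bar>real_of_int (int a * int r - int b * int q)\<bar>" by linarith
  ultimately show ?thesis by (simp add: abs_mult divide_right_mono)
qed

text \<open>Distinct reduced fractions are at least 1/(q r) apart, and the two radii do not exceed
  this together. The arcs therefore overlap at most in endpoints and fit into one period, over which
  the integral is |A|.\<close>

lemma sum_arc_integrals_le:
  fixes A :: "int set" and Q :: real
  assumes A: "finite A" and S: "finite S" "\<And>q. q \<in> S \<Longrightarrow> q \<ge> 1 \<and> real q \<le> Q"
  shows "(\<Sum>q\<in>S. \<Sum>a\<in>totatives q. integral {- arc_radius Q q..arc_radius Q q} (\<lambda>\<beta>. (cmod (expsum1 A (real a / real q + \<beta>)))\<^sup>2)) \<le> real (card A)"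
proof (cases "S = {}")
  case False
  then have Q: "Q \<ge> 1" using S(2) by force
  let ?f = "\<lambda>\<theta>. (cmod (expsum1 A \<theta>))\<^sup>2"
  let ?I = "Sigma S totatives"
  define B where "B = (\<lambda>(q, a). {real a / real q - arc_radius Q q .. real a / real q + arc_radius Q q})"
  define s where "s = arc_radius Q 1"
  have int: "?f integrable_on {x..y}" for x y
    by (intro integrable_continuous_interval continuous_intros)
  have shift: "integral {- arc_radius Q q..arc_radius Q q} (\<lambda>\<beta>. ?f (real a / real q + \<beta>)) = integral (B (q, a)) ?f" for q a
    using integral_shift_Icc_real[where f = ?f and c = "real a / real q" and a = "- arc_radius Q q" and b = "arc_radius Q q"]
    by (simp add: B_def comp_def algebra_simps)
  have sep: "arc_radius Q q + arc_radius Q r \<le> \<bar>real a / real q - real b / real r\<bar>"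
    if "q \<ge> 1" "r \<ge> 1" "real q \<le> Q" "real r \<le> Q" "a * r \<noteq> b * q" for q r a b :: nat
    using arc_radius_add_le[of q r Q] fractions_distance[of q r a b] that by linarith
  have disj: "negligible (B x \<inter> B y)" if xy: "x \<in> ?I" "y \<in> ?I" "x \<noteq> y" for x y
  proof -
    obtain q a r b where [simp]: "x = (q, a)" "y = (r, b)" by (cases x, cases y) auto
    have q: "q \<ge> 1" "real q \<le> Q" "coprime a q" and r: "r \<ge> 1" "real r \<le> Q" "coprime b r"
      using xy S(2) by (auto simp: in_totatives_iff)
    have "a * r \<noteq> b * q"
    proof
      assume eq: "a * r = b * q"
      then have "q dvd r" using q(3) by (metis coprime_commute coprime_dvd_mult_right_iff dvd_triv_right)
      moreover have "r dvd q" using eq r(3) by (metis coprime_commute coprime_dvd_mult_right_iff dvd_triv_right)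
      ultimately have "q = r" by (rule dvd_antisym)
      then show False using eq xy q(1) by auto
    qed
    then have "arc_radius Q q + arc_radius Q r \<le> \<bar>real a / real q - real b / real r\<bar>"
      using sep q r by blast
    then have "B x \<inter> B y \<subseteq> {real a / real q - arc_radius Q q, real a / real q + arc_radius Q q}"
      by (auto simp: B_def)
    then show ?thesis using negligible_finite finite_subset by blast
  qed
  \<comment> \<open>The fraction \<open>0/1\<close> separates the leftmost arc from \<open>s\<close>, so no reduction modulo 1 is needed.\<close>
  have sub: "B x \<subseteq> {s..s+1}" if "x \<in> ?I" for x
  proof -
    obtain q a where x: "x = (q, a)" by (cases x) auto
    have q: "q \<ge> 1" "real q \<le> Q" and a: "a > 0" "a \<le> q" using that S(2) x by (auto simp: in_totatives_iff)
    have "arc_radius Q q + arc_radius Q 1 \<le> \<bar>real a / real q - real 0 / real (1::nat)\<bar>"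
      by (rule sep) (use q Q a in auto)
    then have "s \<le> real a / real q - arc_radius Q q" by (simp add: s_def)
    \<comment> \<open>The largest radius belongs to q = 1, so even the arc around 1 ends by 1 +
      s.\<close>
    moreover have "arc_radius Q q \<le> s"
    proof -
      have "1 * (1 + Q) \<le> real q * (real q + Q)" using q Q by (intro mult_mono) auto
      then show ?thesis using Q by (simp add: s_def arc_radius_def frac_le)
    qed
    moreover have "real a / real q \<le> 1" using q a by simp
    ultimately show ?thesis by (auto simp: B_def x)
  qed
  have fin: "finite ?I" using S(1) by auto
  have U: "(?f has_integral (\<Sum>x\<in>?I. integral (B x) ?f)) (\<Union>x\<in>?I. B x)"
  proof (rule has_integral_UN[OF fin])
    show "(?f has_integral integral (B i) ?f) (B i)" for i
      by (cases i) (simp add: B_def integrable_integral int)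
    show "pairwise (\<lambda>i i'. negligible (B i \<inter> B i')) ?I"
      using disj by (auto simp: pairwise_def)
  qed
  have "(\<Sum>q\<in>S. \<Sum>a\<in>totatives q. integral {- arc_radius Q q..arc_radius Q q} (\<lambda>\<beta>. ?f (real a / real q + \<beta>)))
      = (\<Sum>x\<in>?I. integral (B x) ?f)"
    unfolding shift using S(1) by (simp add: sum.Sigma)
  also have "\<dots> = integral (\<Union>x\<in>?I. B x) ?f"
    by (rule integral_unique[OF U, symmetric])
  also have "\<dots> \<le> integral {s..s+1} ?f"
  proof (rule integral_subset_le)
    show "(\<Union>x\<in>?I. B x) \<subseteq> {s..s+1}" using sub by (rule UN_least)
    show "?f integrable_on (\<Union>x\<in>?I. B x)" using U by (rule has_integral_integrable)
  qed (simp_all add: int)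
  also have "\<dots> = real (card A)"
    by (rule integral_unique[OF has_integral_cmod_expsum1_period[OF A]])
  finally show ?thesis .
qed simp

section \<open>The sieve bound\<close>

theorem corollary1p2:
  fixes M N :: int and Q :: real and L :: "nat \<Rightarrow> int set"
  assumes "N \<ge> 1" and "Q \<ge> 1"
    and "\<And>p. prime p \<Longrightarrow> real p \<le> Q \<Longrightarrow> L p \<subset> {0..<int p}"
  shows "real (card (sifted_set M N Q L)) \<le> 1 / sieve_sum N Q L"
proof -
  define A where "A = sifted_set M N Q L"
  define g where "g q = (\<Prod>p\<in>prime_factors q. real (card (L p)) / (real p - real (card (L p))))" for q
  define w where "w q = of_int N + sieve_const * real q * (real q + Q)" for q :: nat
  let ?f = "\<lambda>\<theta>. (cmod (expsum1 A \<theta>))\<^sup>2"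
  define S where "S = {q::nat. 1 \<le> q \<and> real q \<le> Q}"
  have "S \<subseteq> {..nat \<lfloor>Q\<rfloor>}"
    by (auto simp: S_def le_nat_floor)
  then have finS: "finite S" using finite_subset by blast
  have sub: "A \<subseteq> {M..M + N}" by (auto simp: A_def sifted_set_def)
  then have finA: "finite A" using finite_subset by blast
  have pfQ: "prime p" "real p \<le> Q" if "q \<in> S" "p \<in> prime_factors q" for p q
  proof -
    show "prime p" using that by auto
    have "p \<le> q" using that by (intro dvd_imp_le) (auto simp: S_def)
    then show "real p \<le> Q" using that by (auto simp: S_def)
  qed
  have r: "arc_radius Q q > 0" "of_int N + sieve_const / arc_radius Q q = w q" if "q \<in> S" for q
    using that \<open>Q \<ge> 1\<close> by (auto simp: arc_radius_def w_def S_def)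
  \<comment> \<open>The sign comes from 0 < \<open>selberg_norm\<close> \<le> D +
    \<open>sieve_const\<close>, without a numerical estimate of the constant.\<close>
  have wpos: "w q > 0" if "q \<in> S" for q
  proof -
    let ?D = "arc_radius Q q * of_int N"
    have "0 < ?D" using r(1)[OF that] \<open>N \<ge> 1\<close> by simp
    then have "0 < ?D + sieve_const" using selberg_norm_pos[of ?D] selberg_norm_le[of ?D] by linarith
    then have "0 < (?D + sieve_const) / arc_radius Q q" using r(1)[OF that] by simp
    then show ?thesis using r[OF that] by (simp add: add_divide_distrib)
  qed
  have gnn: "g q \<ge> 0" if "q \<in> S" for q
    unfolding g_def
  proof (rule prod_nonneg)
    fix p assume "p \<in> prime_factors q"
    then have "L p \<subset> {0..<int p}" using assms(3) pfQ that by blast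
    then have "card (L p) < p" using psubset_card_mono[of "{0..<int p}" "L p"] by simp
    then show "real (card (L p)) / (real p - real (card (L p))) \<ge> 0" by simp
  qed
  have L: "sieve_sum N Q L = (\<Sum>q\<in>S. if squarefree q then g q / w q else 0)"
    unfolding sieve_sum_def S_def[symmetric] g_def[symmetric] w_def[symmetric]
    by (intro sum.cong refl) (simp add: moebius_def power_even_eq[symmetric] flip: power_mult)
  \<comment> \<open>The term q = 1 has an empty product and is positive, so dividing by the sum is
    meaningful at the end.\<close>
  have "0 < (\<Sum>q\<in>S. if squarefree q then g q / w q else 0)"
  proof (rule sum_pos2[OF finS])
    show "1 \<in> S" using \<open>Q \<ge> 1\<close> by (simp add: S_def)
    then show "0 < (if squarefree (1::nat) then g 1 / w 1 else 0)" using wpos by (simp add: g_def)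
    show "0 \<le> (if squarefree q then g q / w q else 0)" if "q \<in> S" for q
      using gnn[OF that] wpos[OF that] by simp
  qed
  then have Lpos: "sieve_sum N Q L > 0" unfolding L .
  have local: "(real (card A))\<^sup>2 * (if squarefree q then g q / w q else 0)
      \<le> (\<Sum>a\<in>totatives q. integral {- arc_radius Q q..arc_radius Q q} (\<lambda>\<beta>. ?f (real a / real q + \<beta>)))" if q: "q \<in> S" for q
  proof (cases "squarefree q")
    case True
    let ?R = "{- arc_radius Q q..arc_radius Q q}"
    have i: "?f integrable_on ?R" "(\<lambda>\<beta>. ?f (real a / real q + \<beta>)) integrable_on ?R" for a
      by (intro integrable_continuous_interval continuous_intros)+
    have "(real (card A))\<^sup>2 \<le> w q * integral ?R ?f"
      using card_squared_le_local_integral[OF finA sub \<open>N \<ge> 1\<close> r(1)[OF q]] unfolding r(2)[OF q] .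
    then have "(real (card A))\<^sup>2 * (g q / w q) \<le> w q * integral ?R ?f * (g q / w q)"
      by (rule mult_right_mono) (use gnn wpos q in \<open>auto intro: divide_nonneg_pos\<close>)
    also have "\<dots> = integral ?R (\<lambda>\<beta>. g q * ?f \<beta>)"
      using wpos[OF q] by simp
    also have "\<dots> \<le> integral ?R (\<lambda>\<beta>. \<Sum>a\<in>totatives q. ?f (real a / real q + \<beta>))"
    proof (rule integral_le)
      show "(\<lambda>\<beta>. g q * ?f \<beta>) integrable_on ?R" "(\<lambda>\<beta>. \<Sum>a\<in>totatives q. ?f (real a / real q + \<beta>)) integrable_on ?R"
        by (intro integrable_continuous_interval continuous_intros)+
      fix \<beta>
      \<comment> \<open>The shift by \<beta> is carried by the weights, so Montgomery's inequality
        at 0 gives the inequality at every \<beta> in the arc.\<close>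
      have "g q * (cmod (exp_sum A (\<lambda>n. 1 * cis (2 * pi * \<beta> * of_int n)) 0))\<^sup>2
        \<le> (\<Sum>a\<in>totatives q. (cmod (exp_sum A (\<lambda>n. 1 * cis (2 * pi * \<beta> * of_int n)) (real a / real q)))\<^sup>2)"
        unfolding g_def
      proof (rule montgomery_squarefree[OF finA True])
        fix p assume "p \<in> prime_factors q"
        then show "L p \<subset> {0..<int p} \<and> (\<forall>n\<in>A. n mod int p \<notin> L p)"
          using pfQ[OF q] assms(3) by (auto simp: A_def sifted_set_def)
      qed
      then show "g q * ?f \<beta> \<le> (\<Sum>a\<in>totatives q. ?f (real a / real q + \<beta>))"
        unfolding exp_sum_shift by simp
    qed
    also have "\<dots> = (\<Sum>a\<in>totatives q. integral ?R (\<lambda>\<beta>. ?f (real a / real q + \<beta>)))"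
      by (rule integral_sum) (use i in auto)
    finally show ?thesis using True by simp
  next
    case False
    then show ?thesis
      by (simp add: sum_nonneg integral_nonneg integrable_continuous_interval continuous_intros)
  qed
  have "(real (card A))\<^sup>2 * sieve_sum N Q L \<le> (\<Sum>q\<in>S. \<Sum>a\<in>totatives q. integral {- arc_radius Q q..arc_radius Q q} (\<lambda>\<beta>. ?f (real a / real q + \<beta>)))"
    unfolding L sum_distrib_left by (intro sum_mono local)
  also have "\<dots> \<le> real (card A)"
    by (rule sum_arc_integrals_le[OF finA finS]) (auto simp: S_def)
  finally have "real (card A) * (real (card A) * sieve_sum N Q L) \<le> real (card A) * 1"
    by (simp add: power2_eq_square mult.assoc)
  \<comment> \<open>One factor |A| is cancelled; for empty \<open>A\<close> the bound is
    trivial.\<close>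
  then have "real (card A) * sieve_sum N Q L \<le> 1"
    by (cases "card A = 0") auto
  then show ?thesis using Lpos by (simp add: A_def field_simps)
qed

end
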